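(* Let $n\geq 2$ and $n+1\leq m\leq 2n-1$, and let $F$ be a non-empty linear forest on $m$ vertices. Then (1) $R(P_n,K_1\vee F)\leq m+n-2+\mathrm{pa}(m)$; and (2) $R(P_n,K_1\vee F)\geq \max\left\{2n-1,\ \lceil 3m/2\rceil-1,\ m+n-o(F)-2\right\}$.
   Context: All graphs are finite and simple. $P_n$ denotes the path on $n$ vertices. A linear forest is a forest each of whose components is a path; it is non-empty if it has at least one edge. $K_1\vee F$ denotes the join of a single vertex with $F$ (a new vertex adjacent to every vertex of $F$). $o(F)$ denotes the number of components of $F$ having an odd number of vertices. $\mathrm{pa}(m)$ is the parity of $m$: $0$ if $m$ is even and $1$ if $m$ is odd. For graphs $G_1,G_2$, the Ramsey number $R(G_1,G_2)$ is the least integer $r$ such that for every graph $G$ on $r$ vertices, either $G$ contains a subgraph isomorphic to $G_1$ or the complement $\overline{G}$ contains a subgraph isomorphic to $G_2$. *)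

theory Defs
  imports Complex_Main "Graph_Theory.Graph_Theory"
begin

text \<open>
  A finite simple graph is a \<^locale>\<open>pair_graph\<close>: every edge is represented by the two
  opposite pairs of its endpoints.
\<close>

definition path_graph :: "nat \<Rightarrow> nat pair_pre_digraph" where
  "path_graph n = \<lparr>pverts = {..<n}, parcs = {(i, j). i < n \<and> j < n \<and> (j = Suc i \<or> i = Suc j)}\<rparr>"

definition graph_complement :: "'a pair_pre_digraph \<Rightarrow> 'a pair_pre_digraph" where
  "graph_complement G = \<lparr>pverts = pverts G,
     parcs = {(u, v). u \<in> pverts G \<and> v \<in> pverts G \<and> u \<noteq> v \<and> (u, v) \<notin> parcs G}\<rparr>"

text \<open>The join of a single vertex, represented by \<^const>\<open>None\<close>, with a graph.\<close>

definition cone :: "'a pair_pre_digraph \<Rightarrow> 'a option pair_pre_digraph" where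
  "cone F = \<lparr>pverts = insert None (Some ` pverts F),
     parcs = {(Some u, Some v) | u v. (u, v) \<in> parcs F}
           \<union> {(None, Some v) | v. v \<in> pverts F}
           \<union> {(Some v, None) | v. v \<in> pverts F}\<rparr>"

text \<open>
  The components of a symmetric digraph are its strongly connected components.
\<close>

definition components :: "'a pair_pre_digraph \<Rightarrow> ('a, 'a \<times> 'a) pre_digraph set" where
  "components G = pre_digraph.sccs (with_proj G)"

definition odd_components :: "'a pair_pre_digraph \<Rightarrow> nat" where
  "odd_components G = card {C \<in> components G. odd (card (verts C))}"

text \<open>
  An edge and its reverse form a closed walk of length 2 that satisfies the library
  definition of a cycle, so \<^const>\<open>forest\<close> is false for every symmetric digraph with an
  edge.  Cycles of an undirected graph have length at least 3.
\<close>

definition undirected_forest :: "'a pair_pre_digraph \<Rightarrow> bool" where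
  "undirected_forest G \<longleftrightarrow> (\<nexists>p. pre_digraph.cycle (with_proj G) p \<and> 3 \<le> length p)"

definition linear_forest :: "'a pair_pre_digraph \<Rightarrow> bool" where
  "linear_forest F \<longleftrightarrow> pair_graph F \<and> undirected_forest F \<and>
     (\<forall>C \<in> components F. \<exists>k. digraph_iso C (with_proj (path_graph k)))"

text \<open>The subgraph need not be induced.\<close>

definition contains_copy :: "'a pair_pre_digraph \<Rightarrow> 'b pair_pre_digraph \<Rightarrow> bool" where
  "contains_copy G H \<longleftrightarrow> (\<exists>H'. subgraph H' (with_proj G) \<and> digraph_iso (with_proj H) H')"

text \<open>
  Every finite graph is isomorphic to one whose vertices are natural numbers, so the
  quantification over graphs on \<^term>\<open>r\<close> vertices is restricted to these.
\<close>

definition ramsey_number :: "'a pair_pre_digraph \<Rightarrow> 'b pair_pre_digraph \<Rightarrow> nat" where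
  "ramsey_number G1 G2 = (LEAST r. \<forall>G :: nat pair_pre_digraph.
     pair_graph G \<and> card (pverts G) = r \<longrightarrow>
       contains_copy G G1 \<or> contains_copy (graph_complement G) G2)"

definition pa :: "nat \<Rightarrow> nat" where
  "pa m = (if even m then 0 else 1)"

lemma pair_graphI:
  assumes "finite (pverts G)" "\<And>u v. (u, v) \<in> parcs G \<Longrightarrow> u \<in> pverts G \<and> v \<in> pverts G \<and> u \<noteq> v \<and> (v, u) \<in> parcs G"
  shows "pair_graph G"
proof -
  have "parcs G \<subseteq> pverts G \<times> pverts G"
    using assms(2) by auto
  then have "finite (parcs G)"
    using assms(1) finite_subset by blast
  then show ?thesis
    using assms by unfold_locales (auto simp: symmetric_def intro!: symI)
qed

lemma pair_graph_path_graph: "pair_graph (path_graph n)"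
  by (rule pair_graphI) (auto simp: path_graph_def)

lemma pair_graph_graph_complement:
  assumes "pair_graph G"
  shows "pair_graph (graph_complement G)"
proof -
  interpret pair_graph G by fact
  have "(v, u) \<in> parcs G \<Longrightarrow> (u, v) \<in> parcs G" for u v
    using pair_sym_arcs by (auto simp: symmetric_def dest: symD)
  then show ?thesis
    using pair_finite_verts by (intro pair_graphI) (auto simp: graph_complement_def)
qed

lemma pair_graph_cone:
  assumes "pair_graph F"
  shows "pair_graph (cone F)"
proof -
  interpret pair_graph F by fact
  have sym: "(v, u) \<in> parcs F" if "(u, v) \<in> parcs F" for u v
    using that pair_sym_arcs by (auto simp: symmetric_def dest: symD)
  have irrefl: "(u, u) \<notin> parcs F" for u
    using no_loops' by blast
  show ?thesis
    by (rule pair_graphI)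
      (auto simp: cone_def pair_finite_verts irrefl intro: sym in_arcsD1 in_arcsD2)
qed

lemma contains_copy_iff:
  assumes G: "pair_graph G" and H: "pair_graph H"
  shows "contains_copy G H \<longleftrightarrow>
    (\<exists>f. inj_on f (pverts H) \<and> f ` pverts H \<subseteq> pverts G \<and>
      (\<forall>(u, v) \<in> parcs H. (f u, f v) \<in> parcs G))"
proof
  assume "contains_copy G H"
  then obtain h where h: "pre_digraph.digraph_isomorphism (with_proj H) h"
    "subgraph (app_iso h (with_proj H)) (with_proj G)"
    by (auto simp: contains_copy_def digraph_iso_def)
  have "(iso_verts h u, iso_verts h v) \<in> parcs G" if "(u, v) \<in> parcs H" for u v
  proof -
    from h(2) have "iso_tail h = fst" "iso_head h = snd"
      by (auto simp: subgraph_def compatible_def)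
    with h(1) that have "iso_arcs h (u, v) = (iso_verts h u, iso_verts h v)"
      by (auto simp: pre_digraph.digraph_isomorphism_def prod_eq_iff)
    with h(2) that show ?thesis
      by (force simp: subgraph_def)
  qed
  with h show "\<exists>f. inj_on f (pverts H) \<and> f ` pverts H \<subseteq> pverts G \<and>
      (\<forall>(u, v) \<in> parcs H. (f u, f v) \<in> parcs G)"
    by (intro exI[of _ "iso_verts h"])
      (auto simp: pre_digraph.digraph_isomorphism_def subgraph_def)
next
  interpret G: pair_graph G by fact
  interpret H: pair_graph H by fact
  assume "\<exists>f. inj_on f (pverts H) \<and> f ` pverts H \<subseteq> pverts G \<and>
      (\<forall>(u, v) \<in> parcs H. (f u, f v) \<in> parcs G)"
  then obtain f where f: "inj_on f (pverts H)" "f ` pverts H \<subseteq> pverts G"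
    "\<And>u v. (u, v) \<in> parcs H \<Longrightarrow> (f u, f v) \<in> parcs G"
    by (metis (no_types, lifting) case_prodD)
  define h where "h = \<lparr>iso_verts = f, iso_arcs = map_prod f f, iso_head = snd, iso_tail = fst\<rparr>"
  have inj: "inj_on (map_prod f f) (parcs H)"
    by (rule inj_onI) (use H.in_arcsD1 H.in_arcsD2 f(1) in \<open>auto dest!: inj_onD[OF f(1)]\<close>)
  have iso: "pre_digraph.digraph_isomorphism (with_proj H) h"
    using f(1) inj H.wf_digraph by (auto simp: pre_digraph.digraph_isomorphism_def h_def)
  have wf: "wf_digraph (app_iso h (with_proj H))"
    using iso H.wf_digraphI_app_iso by blast
  have "subgraph (app_iso h (with_proj H)) (with_proj G)"
    using f(2,3) wf G.wf_digraph by (auto simp: subgraph_def compatible_def h_def)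
  with iso show "contains_copy G H"
    by (auto simp: contains_copy_def digraph_iso_def)
qed

end

theory Submission
  imports Defs
begin

text \<open>
  The lower bounds come from disjoint unions of at most three cliques of order less than \<open>n\<close>: a cone
  in the complement has its hub in one clique and the linear forest in the others, which is
  impossible if there are too few vertices left, or, since the vertices of the forest in either of
  the two other cliques form a vertex cover, if one of these is smaller than the matching number
  \<open>(m - o(F)) / 2\<close>.

  For the upper bound, replacing \<open>m\<close> by \<open>m + pa m\<close>, let \<open>m \<le> 2 n\<close> be even and \<open>m + n - 2\<close> the order of
  \<open>G\<close>; it suffices to find a hub with an \<open>m\<close>-vertex path of the complement among its non-neighbours
  (for \<open>n = 2\<close> the graph \<open>G\<close> has no edges and \<open>m = 3\<close>). If every degree is at
  least \<open>n div 2\<close>, then all components of the \<open>P\<^sub>n\<close>-free graph \<open>G\<close> have less than \<open>n\<close> vertices, and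
  any vertex of a smallest component is a hub. Otherwise take a vertex \<open>v\<close> of small degree and a
  longest path of the complement among the non-neighbours of \<open>v\<close>. As in the theorem of
  Gerencser and Gyarfas on the Ramsey numbers of paths, the vertices outside this path can be
  linked through it to a long path of \<open>G\<close>. This contradicts \<open>P\<^sub>n\<close>-freeness unless \<open>n\<close> is even and the
  structure is extremal; then \<open>v\<close> or an end of the complement path is a hub.
\<close>

section \<open>Paths in a relation\<close>

definition rpath :: "('a \<Rightarrow> 'a \<Rightarrow> bool) \<Rightarrow> 'a set \<Rightarrow> 'a list \<Rightarrow> bool" where
  "rpath R V xs \<longleftrightarrow> distinct xs \<and> set xs \<subseteq> V \<and> successively R xs"

definition longest_rpath :: "('a \<Rightarrow> 'a \<Rightarrow> bool) \<Rightarrow> 'a set \<Rightarrow> 'a list \<Rightarrow> bool" where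
  "longest_rpath R V xs \<longleftrightarrow> rpath R V xs \<and> (\<forall>ys. rpath R V ys \<longrightarrow> length ys \<le> length xs)"

lemma rpath_Nil [simp]: "rpath R V []"
  by (simp add: rpath_def)

lemma rpath_mono: "rpath R V xs \<Longrightarrow> V \<subseteq> W \<Longrightarrow> rpath R W xs"
  by (auto simp: rpath_def)

lemma rpath_Cons:
  "rpath R V (x # xs) \<longleftrightarrow>
    x \<in> V \<and> x \<notin> set xs \<and> (xs = [] \<or> R x (hd xs)) \<and> rpath R V xs"
  by (auto simp: rpath_def successively_Cons)

lemma rpath_append:
  "rpath R V (xs @ ys) \<longleftrightarrow> rpath R V xs \<and> rpath R V ys \<and> set xs \<inter> set ys = {} \<and>
    (xs = [] \<or> ys = [] \<or> R (last xs) (hd ys))"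
  by (auto simp: rpath_def successively_append_iff)

lemma rpath_rev [simp]:
  assumes "symp R"
  shows "rpath R V (rev xs) \<longleftrightarrow> rpath R V xs"
proof -
  have "successively (\<lambda>x y. R y x) xs \<longleftrightarrow> successively R xs"
    using assms by (intro successively_cong) (auto dest: sympD)
  then show ?thesis by (simp add: rpath_def)
qed

lemma rpath_take: "rpath R V xs \<Longrightarrow> rpath R V (take i xs)"
  by (metis append_take_drop_id rpath_append)

lemma rpath_length_le:
  assumes "finite V" "rpath R V xs"
  shows "length xs \<le> card V"
  using assms by (metis card_mono distinct_card rpath_def)

lemma longest_rpath_exists:
  assumes "finite V"
  obtains xs where "longest_rpath R V xs"
proof -
  have "\<exists>xs. rpath R V xs \<and> (\<forall>ys. rpath R V ys \<longrightarrow> length ys \<le> length xs)"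
    by (rule ex_has_greatest_nat[of _ "[]" _ "Suc (card V)"])
      (use rpath_length_le[OF assms] in \<open>auto simp: less_Suc_eq_le\<close>)
  then show ?thesis
    using that by (auto simp: longest_rpath_def)
qed

lemma longest_rpath_nonempty:
  assumes "longest_rpath R V xs" "x \<in> V"
  shows "xs \<noteq> []"
proof -
  have "rpath R V [x]" using assms by (simp add: rpath_def)
  then show ?thesis using assms unfolding longest_rpath_def by fastforce
qed

lemma rpath_of_clique:
  assumes "finite W" "W \<subseteq> V" "\<And>x y. x \<in> W \<Longrightarrow> y \<in> W \<Longrightarrow> x \<noteq> y \<Longrightarrow> R x y"
  obtains xs where "rpath R V xs" "length xs = card W"
proof -
  obtain xs where xs: "set xs = W" "distinct xs"
    using assms(1) finite_distinct_list by blast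
  have "successively R xs"
    using assms(3) xs by (auto simp: successively_conv_nth nth_eq_iff_index_eq)
  with xs assms(2) show ?thesis
    using that[of xs] distinct_card[of xs] by (simp add: rpath_def)
qed

text \<open>The relation \<open>\<lambda>_ _. True\<close> reduces the first two hypotheses to
  distinctness and containment in \<open>V\<close>: adjacency comes only from the pairs across the
  two lists.\<close>

lemma rpath_splice:
  assumes "rpath (\<lambda>_ _. True) V xs" "rpath (\<lambda>_ _. True) V ys" "length xs = length ys"
    and "set xs \<inter> set ys = {}" "symp R" "\<And>x y. x \<in> set xs \<Longrightarrow> y \<in> set ys \<Longrightarrow> R x y"
  shows "rpath R V (splice xs ys)"
  using assms(3,1,2,4,6)
proof (induction xs ys rule: list_induct2)
  case Nil
  then show ?case by simp
next
  case (Cons x xs y ys)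
  have set: "set (splice xs ys) = set xs \<union> set ys"
    using set_shuffles[OF splice_in_shuffles] .
  have "rpath R V (splice xs ys)"
    using Cons.prems by (intro Cons.IH) (auto simp: rpath_def successively_Cons)
  moreover have "R y (hd (splice xs ys))" if "splice xs ys \<noteq> []"
  proof -
    have "xs \<noteq> []" using that Cons.hyps by (cases xs) auto
    then have "hd (splice xs ys) = hd xs" "hd xs \<in> set (x # xs)" by (cases xs; simp)+
    then show ?thesis using Cons.prems(4)[of "hd xs" y] \<open>symp R\<close> by (auto dest: sympD)
  qed
  ultimately show ?case
    using Cons.prems set by (auto simp: rpath_Cons)
qed

text \<open>Vertices are taken alternately from \<open>X\<close> and \<open>Y\<close>. The start in
  \<open>X\<close> is recorded so that further vertices can be put in front of the path.\<close>

lemma rpath_between: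
  assumes "finite X" "finite Y" "X \<inter> Y = {}" "symp R" "k \<le> card X" "k \<le> card Y"
    and "\<And>x y. x \<in> X \<Longrightarrow> y \<in> Y \<Longrightarrow> R x y"
  shows "\<exists>xs. rpath R (X \<union> Y) xs \<and> length xs = 2 * k \<and> (0 < k \<longrightarrow> hd xs \<in> X)"
proof -
  obtain X' Y' where XY: "X' \<subseteq> X" "card X' = k" "Y' \<subseteq> Y" "card Y' = k"
    using assms(5,6) by (meson obtain_subset_with_card_n)
  obtain xs ys where xs: "set xs = X'" "distinct xs" and ys: "set ys = Y'" "distinct ys"
    using XY assms(1,2) finite_subset finite_distinct_list by metis
  have len: "length xs = k" "length ys = k"
    using xs ys XY distinct_card by metis+
  have "rpath R (X \<union> Y) (splice xs ys)"
    using xs ys XY assms(3,4) len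
    by (intro rpath_splice) (auto simp: rpath_def successively_conv_nth intro!: assms(7))
  moreover have "hd (splice xs ys) \<in> X" if "0 < k"
    using xs XY len that by (cases xs) auto
  ultimately show ?thesis
    using len by (intro exI[of _ "splice xs ys"]) (simp add: mult_2)
qed

text \<open>The cycle is cut open just before \<open>u\<close>, and \<open>x\<close> is put in
  front.\<close>

lemma rpath_extend_cycle:
  assumes "symp R" "rpath R V c" "R (last c) (hd c)"
    and "u \<in> set c" "x \<in> V - set c" "R x u"
  obtains ys where "rpath R V ys" "length ys = Suc (length c)"
proof -
  obtain as bs where c: "c = as @ u # bs"
    using assms(4) by (meson split_list)
  have "rpath R V (x # u # bs @ as)"
    using assms unfolding c
    by (auto simp: rpath_Cons rpath_append hd_append split: if_splits)
  then show ?thesis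
    using that[of "x # u # bs @ as"] by (simp add: c)
qed

section \<open>Vertices outside a longest path\<close>

text \<open>A colouring of the pairs in \<open>H\<close> with red \<open>R\<close> and blue
  \<open>B\<close>, where a pair may have both colours. It is applied with non-adjacency as
  \<open>R\<close> and adjacency as \<open>B\<close>.\<close>

locale edge_cover =
  fixes R B :: "'a \<Rightarrow> 'a \<Rightarrow> bool" and H :: "'a set"
  assumes symp_R: "symp R" and symp_B: "symp B" and finite_H: "finite H"
    and cover: "x \<in> H \<Longrightarrow> y \<in> H \<Longrightarrow> x \<noteq> y \<Longrightarrow> R x y \<or> B x y"
begin

lemma swap: "edge_cover B R H"
  using symp_R symp_B finite_H cover by unfold_locales blast+

text \<open>Otherwise \<open>y\<close> could be put in front of \<open>ps\<close>.\<close>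

lemma outside_hd:
  assumes "longest_rpath R H ps" "y \<in> H - set ps"
  shows "B y (hd ps)"
proof (rule ccontr)
  assume "\<not> B y (hd ps)"
  moreover have "ps \<noteq> []" using assms longest_rpath_nonempty by fastforce
  moreover have "hd ps \<in> H" using assms \<open>ps \<noteq> []\<close> unfolding longest_rpath_def rpath_def by auto
  moreover have "y \<noteq> hd ps" using assms \<open>ps \<noteq> []\<close> by auto
  ultimately have "rpath R H (y # ps)"
    using assms cover[of y "hd ps"] by (auto simp: longest_rpath_def rpath_Cons)
  then show False
    using assms unfolding longest_rpath_def by fastforce
qed

lemma longest_rev: "longest_rpath R H ps \<Longrightarrow> longest_rpath R H (rev ps)"
  using symp_R by (simp add: longest_rpath_def)

lemma outside_last:
  assumes "longest_rpath R H ps" "y \<in> H - set ps"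
  shows "B y (last ps)"
  using outside_hd[OF longest_rev[OF assms(1)], of y] assms
  by (simp add: hd_rev)

text \<open>Otherwise \<open>y\<close> could be inserted between the two path vertices.\<close>

lemma outside_consecutive:
  assumes ps: "longest_rpath R H ps" and y: "y \<in> H - set ps" and i: "Suc i < length ps"
  shows "B y (ps ! i) \<or> B y (ps ! Suc i)"
proof (rule ccontr)
  assume neg: "\<not> ?thesis"
  define as bs where "as = take i ps" and "bs = drop (Suc (Suc i)) ps"
  have dec: "ps = as @ ps ! i # ps ! Suc i # bs"
    unfolding as_def bs_def using i by (metis Cons_nth_drop_Suc Suc_lessD append_take_drop_id)
  define a b where "a = ps ! i" and "b = ps ! Suc i"
  have dec: "ps = as @ a # b # bs" using dec a_def b_def by simp
  have "a \<in> H" "b \<in> H" "a \<in> set ps" "b \<in> set ps"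
    using ps dec by (auto simp: longest_rpath_def rpath_def)
  then have "R y a" "R y b"
    using neg cover[of y a] cover[of y b] y a_def b_def by auto
  then have "R a y" "R y b"
    using sympD[OF symp_R] by blast+
  then have "rpath R H (as @ a # y # b # bs)"
    using ps y unfolding longest_rpath_def dec
    by (auto simp: rpath_append rpath_Cons)
  moreover have "length (as @ a # y # b # bs) = Suc (length ps)" by (simp add: dec)
  ultimately show False
    using ps unfolding longest_rpath_def by fastforce
qed

text \<open>Otherwise both outside vertices could be inserted between the four path vertices.\<close>

lemma outside_common:
  assumes ps: "longest_rpath R H ps" and y: "y \<in> H - set ps" "z \<in> H - set ps" "y \<noteq> z"
    and i: "i + 3 < length ps"
  shows "\<exists>j. i \<le> j \<and> j \<le> i + 3 \<and> B y (ps ! j) \<and> B z (ps ! j)"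
proof (rule ccontr)
  assume neg: "\<not> ?thesis"
  define as bs where "as = take i ps" and "bs = drop (i + 4) ps"
  define a b c d where abcd: "a = ps ! i" "b = ps ! (i + 1)" "c = ps ! (i + 2)" "d = ps ! (i + 3)"
  have dec: "ps = as @ a # b # c # d # bs"
  proof -
    have "drop j ps = ps ! j # drop (Suc j) ps" if "j < length ps" for j
      using that by (simp add: Cons_nth_drop_Suc)
    from this[of i] this[of "i + 1"] this[of "i + 2"] this[of "i + 3"] i
    have "drop i ps = a # b # c # d # bs"
      by (simp add: abcd bs_def eval_nat_numeral)
    then show ?thesis unfolding as_def by (metis append_take_drop_id)
  qed
  have H: "a \<in> H" "b \<in> H" "c \<in> H" "d \<in> H"
    using ps by (auto simp: longest_rpath_def rpath_def dec)
  have pairs: "B x a \<or> B x b" "B x b \<or> B x c" "B x c \<or> B x d" if "x \<in> H - set ps" for x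
    using outside_consecutive[OF ps that, of i] outside_consecutive[OF ps that, of "i + 1"]
      outside_consecutive[OF ps that, of "i + 2"] i by (auto simp: abcd numeral_3_eq_3)
  have nc: "\<not> (B y a \<and> B z a)" "\<not> (B y b \<and> B z b)" "\<not> (B y c \<and> B z c)" "\<not> (B y d \<and> B z d)"
    using neg[unfolded not_ex, rule_format, of i] neg[unfolded not_ex, rule_format, of "i + 1"]
      neg[unfolded not_ex, rule_format, of "i + 2"] neg[unfolded not_ex, rule_format, of "i + 3"]
    by (simp_all add: abcd)
  \<comment> \<open>Without a common neighbour, the \<open>B\<close>-neighbours of \<open>y\<close>
    and \<open>z\<close> among \<open>a\<close>, \<open>b\<close>, \<open>c\<close>,
    \<open>d\<close> are forced to be \<open>a\<close>, \<open>c\<close> for one and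
    \<open>b\<close>, \<open>d\<close> for the other. Then \<open>a x c b w d\<close> replaces
    \<open>a b c d\<close>, traversing the middle edge backwards.\<close>
  have insert: False if "x \<in> H - set ps" "w \<in> H - set ps" "x \<noteq> w" "R x a" "R x c" "R w b" "R w d" for x w
  proof -
    have "R b c" using ps unfolding longest_rpath_def dec by (auto simp: rpath_append rpath_Cons)
    then have "R a x" "R c b" "R b w" "R x c" "R w d"
      using sympD[OF symp_R] that by blast+
    then have "rpath R H (as @ a # x # c # b # w # d # bs)"
      using ps that unfolding longest_rpath_def dec
      by (auto simp: rpath_append rpath_Cons)
    moreover have "length (as @ a # x # c # b # w # d # bs) = length ps + 2" by (simp add: dec)
    ultimately show False
      using ps unfolding longest_rpath_def by fastforce
  qed
  have R: "R x v" if "\<not> B x v" "x \<in> H - set ps" "v \<in> set ps" for x v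
    using that cover[of x v] ps by (auto simp: longest_rpath_def rpath_def)
  have abcd_in: "a \<in> set ps" "b \<in> set ps" "c \<in> set ps" "d \<in> set ps" by (auto simp: dec)
  show False
    using pairs[OF y(1)] pairs[OF y(2)] nc insert[OF y] insert[OF y(2,1) y(3)[symmetric]]
      R[OF _ y(1)] R[OF _ y(2)] abcd_in by blast
qed

end

section \<open>Families of disjoint paths with both ends among the outside vertices\<close>

definition alternating_family :: "('a \<Rightarrow> 'a \<Rightarrow> bool) \<Rightarrow> 'a set \<Rightarrow> 'a set \<Rightarrow> 'a list list \<Rightarrow> bool" where
  "alternating_family B Y Q xss \<longleftrightarrow> distinct (concat xss) \<and> set (concat xss) \<subseteq> Y \<union> Q \<and>
    (\<forall>xs\<in>set xss. xs \<noteq> [] \<and> successively B xs \<and> hd xs \<in> Y \<and> last xs \<in> Y)"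

text \<open>The paths meet \<open>q\<close> at their last vertices, so the second one is reversed;
  the ends of the result are the two first vertices, again in \<open>Y\<close>.\<close>

lemma alternating_family_join:
  assumes "symp B" "alternating_family B Y Q (xs # zs # xss)" "q \<notin> Y \<union> Q" "Q \<union> {q} \<subseteq> Q'"
    and "B (last xs) q" "B (last zs) q"
  shows "alternating_family B Y Q' ((xs @ q # rev zs) # xss)"
proof -
  have rev: "successively B (rev zs) \<longleftrightarrow> successively B zs"
    unfolding successively_rev using assms(1) by (intro successively_cong) (auto dest: sympD)
  have "B q (last zs)"
    using assms(1,6) by (rule sympD)
  have xz: "xs \<noteq> []" "zs \<noteq> []" "successively B xs" "successively B zs"
      "hd xs \<in> Y" "hd zs \<in> Y"
    and dist: "distinct (concat (xs # zs # xss))" "set (concat (xs # zs # xss)) \<subseteq> Y \<union> Q"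
    and rest: "\<forall>xs\<in>set xss. xs \<noteq> [] \<and> successively B xs \<and> hd xs \<in> Y \<and> last xs \<in> Y"
    using assms(2) by (simp_all add: alternating_family_def)
  have "successively B (xs @ q # rev zs)"
    using xz rev assms(5) \<open>B q (last zs)\<close>
    by (simp add: successively_append_iff successively_Cons hd_rev del: successively_rev)
  moreover have "distinct (concat ((xs @ q # rev zs) # xss))"
    using dist assms(3) by auto
  moreover have "set (concat ((xs @ q # rev zs) # xss)) \<subseteq> Y \<union> Q'"
    using dist assms(4) by auto
  ultimately show ?thesis
    unfolding alternating_family_def using xz rest by (simp add: last_rev)
qed

text \<open>
  The paths are merged through one pair at a time: of three path ends two are adjacent to the same
  member of the pair.
\<close>

lemma alternating_family_exists:
  assumes "symp B" "finite Y"
    and "\<And>i y. i < s \<Longrightarrow> y \<in> Y \<Longrightarrow> B y (a i) \<or> B y (b i)"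
    and "\<And>i. i < s \<Longrightarrow> a i \<notin> Y \<and> b i \<notin> Y"
    and "\<And>i j. i < j \<Longrightarrow> j < s \<Longrightarrow> {a i, b i} \<inter> {a j, b j} = {}"
    and "s + 2 \<le> card Y"
  shows "\<exists>xss. alternating_family B Y (\<Union>i<s. {a i, b i}) xss \<and> length xss = card Y - s \<and>
    length (concat xss) = card Y + s"
  using assms(3-6)
proof (induction s)
  case 0
  obtain ys where ys: "set ys = Y" "distinct ys"
    using assms(2) finite_distinct_list by blast
  have concat: "concat (map (\<lambda>y. [y]) ys) = ys" by (induction ys) auto
  have "alternating_family B Y {} (map (\<lambda>y. [y]) ys)"
    unfolding alternating_family_def concat using ys by simp
  moreover have "length ys = card Y" using distinct_card[OF ys(2)] ys(1) by simp
  ultimately show ?case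
    by (intro exI[of _ "map (\<lambda>y. [y]) ys"]) (simp add: concat)
next
  case (Suc s)
  have "\<exists>xss. alternating_family B Y (\<Union>i<s. {a i, b i}) xss \<and> length xss = card Y - s \<and>
    length (concat xss) = card Y + s"
    using Suc.prems by (intro Suc.IH) auto
  then obtain xss where xss: "alternating_family B Y (\<Union>i<s. {a i, b i}) xss"
    "length xss = card Y - s" "length (concat xss) = card Y + s" by blast
  \<comment> \<open>The bound \<open>Suc s + 2 \<le> card Y\<close> is exactly what keeps three
    paths available before this merge.\<close>
  have "3 \<le> length xss" using xss(2) Suc.prems(4) by simp
  then obtain x y z zs where dec: "xss = x # y # z # zs"
    by (auto simp: numeral_3_eq_3 Suc_le_length_iff)
  have ends: "last x \<in> Y" "last y \<in> Y" "last z \<in> Y"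
    using xss(1) by (auto simp: dec alternating_family_def)
  have "\<exists>q u w v. q \<in> {a s, b s} \<and> B (last u) q \<and> B (last w) q \<and>
    (u, w, v) \<in> {(x, y, z), (x, z, y), (y, z, x)}"
    using Suc.prems(1)[of s "last x"] Suc.prems(1)[of s "last y"] Suc.prems(1)[of s "last z"] ends
    by fastforce
  then obtain q u w v where q: "q \<in> {a s, b s}" "B (last u) q" "B (last w) q"
    and uwv: "(u, w, v) \<in> {(x, y, z), (x, z, y), (y, z, x)}" by blast
  define vs where "vs = v # zs"
  have len: "length (concat (u # w # vs)) = length (concat xss)" "length (u # w # vs) = length xss"
    using uwv by (auto simp: dec vs_def)
  have fam: "alternating_family B Y (\<Union>i<s. {a i, b i}) (u # w # vs)"
    using uwv xss(1) unfolding dec vs_def alternating_family_def by auto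
  have "q \<notin> Y \<union> (\<Union>i<s. {a i, b i})"
    using q(1) Suc.prems(2)[of s] Suc.prems(3)[of _ s] by fastforce
  then have "alternating_family B Y (\<Union>i<Suc s. {a i, b i}) ((u @ q # rev w) # vs)"
    using q(1) by (intro alternating_family_join[OF assms(1) fam _ _ q(2,3)]) (auto simp: less_Suc_eq)
  then show ?case
    using len xss Suc.prems(4) by (intro exI[of _ "(u @ q # rev w) # vs"]) auto
qed

section \<open>Linking the outside vertices through the longest path\<close>

context edge_cover
begin

text \<open>The merging pairs are consecutive path vertices, starting at index 1. After
  \<open>card Y - 2\<close> merges two paths remain, and both ends of \<open>ps\<close> are still
  free, since the last index used is at most \<open>length ps - 2\<close>.\<close>

lemma outside_two_alternating:
  assumes ps: "longest_rpath R H ps" and Y: "Y \<subseteq> H - set ps" "2 \<le> card Y"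
    and len: "2 * card Y \<le> length ps + 2"
  obtains u w where "alternating_family B Y ((!) ps ` {1..2 * card Y - 4}) [u, w]"
    "length u + length w = 2 * card Y - 2"
proof -
  define s where "s = card Y - 2"
  have fin: "finite Y" using Y(2) by (auto intro: card_ge_0_finite)
  have dist: "distinct ps" using ps by (simp add: longest_rpath_def rpath_def)
  have lt: "2 * i + 2 < length ps" if "i < s" for i
    using that len Y(2) by (simp add: s_def)
  have "\<exists>xss. alternating_family B Y (\<Union>i<s. {ps ! (2 * i + 1), ps ! (2 * i + 2)}) xss \<and>
    length xss = card Y - s \<and> length (concat xss) = card Y + s"
  proof (rule alternating_family_exists[OF symp_B fin])
    fix i y assume "i < s" "y \<in> Y"
    then show "B y (ps ! (2 * i + 1)) \<or> B y (ps ! (2 * i + 2))"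
      using outside_consecutive[OF ps, of y "2 * i + 1"] lt[of i] Y(1) by auto
  next
    fix i assume "i < s"
    then have "ps ! (2 * i + 1) \<in> set ps" "ps ! (2 * i + 2) \<in> set ps"
      using lt[of i] by simp_all
    then show "ps ! (2 * i + 1) \<notin> Y \<and> ps ! (2 * i + 2) \<notin> Y"
      using Y(1) by auto
  next
    fix i j assume "i < j" "j < s"
    then show "{ps ! (2 * i + 1), ps ! (2 * i + 2)} \<inter> {ps ! (2 * j + 1), ps ! (2 * j + 2)} = {}"
      using lt[of i] lt[of j] dist by (auto simp: nth_eq_iff_index_eq)
  qed (use Y in \<open>simp add: s_def\<close>)
  then obtain xss where xss: "alternating_family B Y (\<Union>i<s. {ps ! (2 * i + 1), ps ! (2 * i + 2)}) xss"
    "length xss = 2" "length (concat xss) = 2 * card Y - 2"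
    using Y(2) by (auto simp: s_def)
  then obtain u w where uw: "xss = [u, w]"
    by (auto simp: numeral_2_eq_2 length_Suc_conv)
  have "(\<Union>i<s. {ps ! (2 * i + 1), ps ! (2 * i + 2)}) \<subseteq> (!) ps ` {1..2 * card Y - 4}"
    by (auto simp: s_def intro!: imageI)
  then have "alternating_family B Y ((!) ps ` {1..2 * card Y - 4}) [u, w]"
    using xss(1) unfolding uw alternating_family_def by blast
  then show ?thesis
    using that xss(3) by (simp add: uw)
qed

text \<open>The last conclusion lists the path vertices that stay available for joining
  \<open>u\<close> and \<open>w\<close>: the first one and all those after the pairs.\<close>

lemma outside_two_paths:
  assumes ps: "longest_rpath R H ps" and Y: "Y \<subseteq> H - set ps" "2 \<le> card Y"
    and len: "2 * card Y \<le> length ps + 2"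
  obtains u w where "rpath B H u" "rpath B H w" "set u \<inter> set w = {}" "u \<noteq> []" "w \<noteq> []"
    "hd u \<in> Y" "last u \<in> Y" "hd w \<in> Y" "last w \<in> Y" "length u + length w = 2 * card Y - 2"
    "set u \<union> set w \<subseteq> set ps \<union> Y"
    "\<And>i. i < length ps \<Longrightarrow> i = 0 \<or> 2 * card Y - 4 < i \<Longrightarrow> ps ! i \<notin> set u \<union> set w"
proof -
  let ?k = "2 * card Y - 4"
  obtain u w where uw: "alternating_family B Y ((!) ps ` {1..?k}) [u, w]"
    "length u + length w = 2 * card Y - 2"
    using outside_two_alternating[OF ps Y len] .
  have ends: "set u \<inter> set w = {}" "u \<noteq> []" "w \<noteq> []" "hd u \<in> Y" "last u \<in> Y" "hd w \<in> Y" "last w \<in> Y"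
    and sub: "set u \<union> set w \<subseteq> Y \<union> (!) ps ` {1..?k}"
    and paths: "distinct u" "distinct w" "successively B u" "successively B w"
    using uw(1) by (simp_all add: alternating_family_def)
  have dist: "distinct ps" "set ps \<subseteq> H" using ps by (simp_all add: longest_rpath_def rpath_def)
  have k: "?k < length ps" using len Y(2) by linarith
  have "(!) ps ` {1..?k} \<subseteq> set ps" using k by auto
  then have sub': "set u \<union> set w \<subseteq> set ps \<union> Y" using sub by blast
  then have "set u \<union> set w \<subseteq> H" using Y(1) dist(2) by blast
  then have "rpath B H u" "rpath B H w" using paths by (simp_all add: rpath_def)
  moreover have "ps ! i \<notin> set u \<union> set w" if i: "i < length ps" "i = 0 \<or> ?k < i" for i
  proof -
    have "ps ! i \<noteq> ps ! j" if "j \<in> {1..?k}" for j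
      using dist(1) i k that by (auto simp: nth_eq_iff_index_eq)
    moreover have "ps ! i \<notin> Y" using nth_mem[OF i(1)] Y(1) by blast
    ultimately show ?thesis using sub by blast
  qed
  ultimately show ?thesis using that ends uw(2) sub' by blast
qed

text \<open>Both ends of \<open>ps\<close> are \<open>B\<close>-adjacent to every outside vertex, so
  the first end joins \<open>u\<close> to \<open>w\<close> and the last end is appended.\<close>

lemma exists_even_path:
  assumes ps: "longest_rpath R H ps" and Y: "Y \<subseteq> H - set ps" "Y \<noteq> {}"
    and len: "2 * card Y \<le> length ps + 2"
  obtains xs where "rpath B H xs" "length xs = 2 * card Y"
proof (cases "card Y = 1")
  case True
  then obtain y where y: "Y = {y}" by (meson card_1_singletonE)
  have "ps \<noteq> []" using longest_rpath_nonempty[OF ps] Y by blast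
  then have "rpath B H [y, hd ps]"
    using Y(1) y outside_hd[OF ps, of y] ps by (auto simp: rpath_def longest_rpath_def)
  with True that[of "[y, hd ps]"] show ?thesis by simp
next
  case False
  have fin: "finite Y" using Y(1) finite_H finite_subset by blast
  then have "0 < card Y" using Y(2) by (simp add: card_gt_0_iff)
  with False have t: "2 \<le> card Y" by linarith
  obtain u w where uw: "rpath B H u" "rpath B H w" "set u \<inter> set w = {}" "u \<noteq> []" "w \<noteq> []"
    and Y_ends: "hd u \<in> Y" "last u \<in> Y" "hd w \<in> Y" "last w \<in> Y"
    and len_uw: "length u + length w = 2 * card Y - 2" and sub: "set u \<union> set w \<subseteq> set ps \<union> Y"
    and n: "\<And>i. i < length ps \<Longrightarrow> i = 0 \<or> 2 * card Y - 4 < i \<Longrightarrow> ps ! i \<notin> set u \<union> set w"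
    using outside_two_paths[OF ps Y(1) t] len by auto
  have k: "2 \<le> length ps" "2 * card Y - 4 < length ps - 1" using t len by simp_all
  then have ends: "hd ps = ps ! 0" "last ps = ps ! (length ps - 1)"
    by (simp_all add: hd_conv_nth last_conv_nth flip: length_greater_0_conv)
  have dist: "distinct ps" using ps by (simp add: longest_rpath_def rpath_def)
  have len0: "ps \<noteq> []" using k(1) by auto
  have H: "ps ! i \<in> H" if "i < length ps" for i
    using ps nth_mem[OF that] unfolding longest_rpath_def rpath_def by blast
  have nth: "ps ! 0 \<notin> set u \<union> set w" "ps ! (length ps - 1) \<notin> set u \<union> set w"
      "ps ! 0 \<in> H" "ps ! (length ps - 1) \<in> H"
    using n[of 0] n[of "length ps - 1"] H k len0 by simp_all
  have neq: "ps ! 0 \<noteq> ps ! (length ps - 1)"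
    using dist k len0 by (simp add: nth_eq_iff_index_eq)
  have B: "B (last u) (ps ! 0)" "B (ps ! 0) (hd w)" "B (last w) (ps ! (length ps - 1))"
    using outside_hd[OF ps] outside_last[OF ps] Y(1) Y_ends unfolding ends by (blast intro: sympD[OF symp_B])+
  have "rpath B H (u @ ps ! 0 # w @ [ps ! (length ps - 1)])"
    using uw nth neq B by (auto simp: rpath_append rpath_Cons)
  then show ?thesis
    using that[of "u @ ps ! 0 # w @ [ps ! (length ps - 1)]"] len_uw t by simp
qed

lemma exists_odd_path:
  assumes ps: "longest_rpath R H ps" and Y: "Y \<subseteq> H - set ps" "Y \<noteq> {}"
    and len: "2 * card Y \<le> length ps"
  obtains xs where "rpath B H xs" "length xs = 2 * card Y + 1"
proof (cases "card Y = 1")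
  case True
  then obtain y where y: "Y = {y}" by (meson card_1_singletonE)
  have "ps \<noteq> []" "tl ps \<noteq> []" using len True by (cases ps; cases "tl ps"; auto)+
  then have "hd ps \<noteq> last ps" "hd ps \<in> set ps" "last ps \<in> set ps"
    using ps by (cases ps; auto simp: longest_rpath_def rpath_def)+
  then have "rpath B H [hd ps, y, last ps]"
    using Y(1) y outside_hd[OF ps, of y] outside_last[OF ps, of y] ps sympD[OF symp_B]
    by (auto simp: rpath_def longest_rpath_def)
  with True that[of "[hd ps, y, last ps]"] show ?thesis by simp
next
  case False
  have fin: "finite Y" using Y(1) finite_H finite_subset by blast
  then have "0 < card Y" using Y(2) by (simp add: card_gt_0_iff)
  with False have t: "2 \<le> card Y" by linarith
  obtain u w where uw: "rpath B H u" "rpath B H w" "set u \<inter> set w = {}" "u \<noteq> []" "w \<noteq> []"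
    and Y_ends: "hd u \<in> Y" "last u \<in> Y" "hd w \<in> Y" "last w \<in> Y"
    and len_uw: "length u + length w = 2 * card Y - 2" and sub: "set u \<union> set w \<subseteq> set ps \<union> Y"
    and n: "\<And>i. i < length ps \<Longrightarrow> i = 0 \<or> 2 * card Y - 4 < i \<Longrightarrow> ps ! i \<notin> set u \<union> set w"
    using outside_two_paths[OF ps Y(1) t] len by auto
  have k: "2 \<le> length ps" "2 * card Y - 4 < length ps - 1" using t len by simp_all
  then have ends: "hd ps = ps ! 0" "last ps = ps ! (length ps - 1)"
    by (simp_all add: hd_conv_nth last_conv_nth flip: length_greater_0_conv)
  obtain j where j: "j \<in> {2 * card Y - 3, 2 * card Y - 2}" "B (hd u) (ps ! j)"
  proof -
    have "Suc (2 * card Y - 3) = 2 * card Y - 2" "2 * card Y - 2 < length ps" "hd u \<in> H - set ps"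
      using t len Y_ends(1) Y(1) by auto
    then show ?thesis
      using outside_consecutive[OF ps, of "hd u" "2 * card Y - 3"] that by force
  qed
  have jk: "j < length ps - 1" "2 * card Y - 4 < j" "0 < j" using j(1) t len by auto
  have dist: "distinct ps" using ps by (simp add: longest_rpath_def rpath_def)
  have len0: "ps \<noteq> []" using k(1) by auto
  have H: "ps ! i \<in> H" if "i < length ps" for i
    using ps nth_mem[OF that] unfolding longest_rpath_def rpath_def by blast
  have nth: "ps ! 0 \<notin> set u \<union> set w" "ps ! (length ps - 1) \<notin> set u \<union> set w" "ps ! j \<notin> set u \<union> set w"
      "ps ! 0 \<in> H" "ps ! (length ps - 1) \<in> H" "ps ! j \<in> H"
    using n[of 0] n[of j] n[of "length ps - 1"] H k jk len0 by simp_all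
  have neq: "ps ! 0 \<noteq> ps ! (length ps - 1)" "ps ! 0 \<noteq> ps ! j" "ps ! j \<noteq> ps ! (length ps - 1)"
    using dist k jk len0 by (simp_all add: nth_eq_iff_index_eq)
  have B: "B (last u) (ps ! 0)" "B (ps ! 0) (hd w)" "B (last w) (ps ! (length ps - 1))" "B (ps ! j) (hd u)"
    using outside_hd[OF ps] outside_last[OF ps] Y(1) Y_ends j(2) unfolding ends by (blast intro: sympD[OF symp_B])+
  have "rpath B H (ps ! j # u @ ps ! 0 # w @ [ps ! (length ps - 1)])"
    using uw nth neq B by (auto simp: rpath_append rpath_Cons)
  then show ?thesis
    using that[of "ps ! j # u @ ps ! 0 # w @ [ps ! (length ps - 1)]"] len_uw t by simp
qed

lemma exists_path_between_ends:
  assumes ps: "longest_rpath R H ps" and Y: "Y \<subseteq> H - set ps" "Y \<noteq> {}"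
    and len: "2 * card Y + 2 \<le> length ps"
  obtains xs where "rpath B (set ps \<union> Y) xs" "length xs = 2 * card Y + 1"
    "hd xs = hd ps" "last xs = last ps"
proof (cases "card Y = 1")
  case True
  then obtain y where y: "Y = {y}" by (meson card_1_singletonE)
  have "ps \<noteq> []" "tl ps \<noteq> []" using len True by (cases ps; cases "tl ps"; auto)+
  then have "hd ps \<noteq> last ps" "hd ps \<in> set ps" "last ps \<in> set ps"
    using ps by (cases ps; auto simp: longest_rpath_def rpath_def)+
  then have "rpath B (set ps \<union> Y) [hd ps, y, last ps]"
    using Y(1) y outside_hd[OF ps, of y] outside_last[OF ps, of y] ps sympD[OF symp_B]
    by (auto simp: rpath_def longest_rpath_def)
  with True that[of "[hd ps, y, last ps]"] show ?thesis by simp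
next
  case False
  have fin: "finite Y" using Y(1) finite_H finite_subset by blast
  then have "0 < card Y" using Y(2) by (simp add: card_gt_0_iff)
  with False have t: "2 \<le> card Y" by linarith
  obtain u w where uw: "rpath B H u" "rpath B H w" "set u \<inter> set w = {}" "u \<noteq> []" "w \<noteq> []"
    and Y_ends: "hd u \<in> Y" "last u \<in> Y" "hd w \<in> Y" "last w \<in> Y"
    and len_uw: "length u + length w = 2 * card Y - 2" and sub: "set u \<union> set w \<subseteq> set ps \<union> Y"
    and n: "\<And>i. i < length ps \<Longrightarrow> i = 0 \<or> 2 * card Y - 4 < i \<Longrightarrow> ps ! i \<notin> set u \<union> set w"
    using outside_two_paths[OF ps Y(1) t] len by auto
  have k: "2 \<le> length ps" "2 * card Y - 4 < length ps - 1" using t len by simp_all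
  then have ends: "hd ps = ps ! 0" "last ps = ps ! (length ps - 1)"
    by (simp_all add: hd_conv_nth last_conv_nth flip: length_greater_0_conv)
  have "last u \<noteq> hd w" using uw(3-5) by (metis disjoint_iff hd_in_set last_in_set)
  then obtain j where j: "2 * card Y - 3 \<le> j" "j \<le> 2 * card Y - 3 + 3"
      "B (last u) (ps ! j)" "B (hd w) (ps ! j)"
  proof -
    have "2 * card Y - 3 + 3 < length ps" "last u \<in> H - set ps" "hd w \<in> H - set ps"
      using t len Y_ends Y(1) by auto
    then show ?thesis
      using outside_common[OF ps _ _ \<open>last u \<noteq> hd w\<close>, of "2 * card Y - 3"] that by blast
  qed
  have jk: "j < length ps - 1" "2 * card Y - 4 < j" "0 < j" using j(1,2) t len by auto
  have dist: "distinct ps" using ps by (simp add: longest_rpath_def rpath_def)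
  have len0: "ps \<noteq> []" using k(1) by auto
  have H: "ps ! i \<in> H" if "i < length ps" for i
    using ps nth_mem[OF that] unfolding longest_rpath_def rpath_def by blast
  have nth: "ps ! 0 \<notin> set u \<union> set w" "ps ! (length ps - 1) \<notin> set u \<union> set w" "ps ! j \<notin> set u \<union> set w"
      "ps ! 0 \<in> H" "ps ! (length ps - 1) \<in> H" "ps ! j \<in> H"
    using n[of 0] n[of j] n[of "length ps - 1"] H k jk len0 by simp_all
  have neq: "ps ! 0 \<noteq> ps ! (length ps - 1)" "ps ! 0 \<noteq> ps ! j" "ps ! j \<noteq> ps ! (length ps - 1)"
    using dist k jk len0 by (simp_all add: nth_eq_iff_index_eq)
  have B: "B (ps ! 0) (hd u)" "B (ps ! j) (hd w)" "B (last w) (ps ! (length ps - 1))"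
    using outside_hd[OF ps] outside_last[OF ps] Y(1) Y_ends j(4) unfolding ends by (blast intro: sympD[OF symp_B])+
  define xs where "xs = ps ! 0 # u @ ps ! j # w @ [ps ! (length ps - 1)]"
  have "rpath B H xs"
    using uw nth neq B j(3) unfolding xs_def by (auto simp: rpath_append rpath_Cons)
  moreover have "set xs \<subseteq> set ps \<union> Y"
  proof -
    have "ps ! 0 \<in> set ps" "ps ! j \<in> set ps" "ps ! (length ps - 1) \<in> set ps"
      using k jk len0 by auto
    then show ?thesis using sub unfolding xs_def by auto
  qed
  ultimately have "rpath B (set ps \<union> Y) xs" by (simp add: rpath_def)
  then show ?thesis
    using that[of xs] len_uw t ends by (simp add: xs_def)
qed

end

section \<open>Graphs without long paths\<close>

context edge_cover
begin

text \<open>With \<open>length ps div 2 + 1\<close> outside vertices,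
  \<open>exists_even_path\<close> already gives more than \<open>length ps\<close> vertices.\<close>

lemma longest_less_longest:
  assumes ps: "longest_rpath R H ps" and qs: "longest_rpath B H qs"
    and card: "length ps div 2 < card (H - set ps)"
  shows "length ps < length qs"
proof -
  obtain Y where Y: "Y \<subseteq> H - set ps" "card Y = length ps div 2 + 1"
    using card by (metis Suc_eq_plus1 Suc_leI obtain_subset_with_card_n)
  have "Y \<noteq> {}" "2 * card Y \<le> length ps + 2" using Y(2) by auto
  then obtain xs where xs: "rpath B H xs" "length xs = 2 * card Y"
    using exists_even_path[OF ps Y(1)] by metis
  have "length xs \<le> length qs" using qs xs(1) by (simp add: longest_rpath_def)
  moreover have "length ps < length xs" using xs(2) Y(2) by simp
  ultimately show ?thesis by simp
qed

lemma longest_rpath_card_diff: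
  assumes "longest_rpath R H ps"
  shows "card (H - set ps) = card H - length ps"
  using assms by (simp add: longest_rpath_def rpath_def card_Diff_subset distinct_card)

text \<open>If both longest paths covered too little of \<open>H\<close>, each would be shorter than
  the other.\<close>

lemma cover_bound:
  assumes ps: "longest_rpath R H ps" and qs: "longest_rpath B H qs"
    and card: "length qs + length qs div 2 < card H"
  shows "card H \<le> length ps + length ps div 2"
proof (rule ccontr)
  assume neg: "\<not> ?thesis"
  interpret s: edge_cover B R H by (rule swap)
  have "length qs < length ps"
    using card by (intro s.longest_less_longest[OF qs ps]) (simp add: s.longest_rpath_card_diff[OF qs])
  moreover have "length ps < length qs"
    using neg by (intro longest_less_longest[OF ps qs]) (simp add: longest_rpath_card_diff[OF ps])
  ultimately show False by simp
qed

end

text \<open>An edge leaving the cycle would give a path with one more vertex than the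
  maximum.\<close>

lemma rpath_cycle_closed:
  assumes "symp E" "rpath E V c" "E (last c) (hd c)" "\<And>xs. rpath E V xs \<Longrightarrow> length xs \<le> length c"
    and "x \<in> V - set c" "u \<in> set c"
  shows "\<not> E x u"
proof
  assume "E x u"
  then obtain ys where "rpath E V ys" "length ys = Suc (length c)"
    using rpath_extend_cycle[OF assms(1-3,6,5)] by blast
  then show False using assms(4)[of ys] by simp
qed

text \<open>The complement of \<open>(V, E)\<close> contains \<open>K\<^sub>1 \<or> P\<^sub>m\<close>.\<close>

definition co_fan :: "('a \<Rightarrow> 'a \<Rightarrow> bool) \<Rightarrow> 'a set \<Rightarrow> nat \<Rightarrow> bool" where
  "co_fan E V m \<longleftrightarrow> (\<exists>h qs. h \<in> V \<and> rpath (\<lambda>x y. \<not> E x y) (V - {h}) qs \<and> length qs = m \<and>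
    (\<forall>q\<in>set qs. \<not> E h q))"

text \<open>The parameter \<open>m\<close> is the even number \<open>m + pa m\<close> of the
  theorem, which explains the bound \<open>2 * n\<close>.\<close>

locale path_free =
  fixes E :: "'a \<Rightarrow> 'a \<Rightarrow> bool" and V :: "'a set" and n m :: nat
  assumes symp: "symp E" and irrefl: "\<not> E x x" and finite: "finite V"
    and adj: "E x y \<Longrightarrow> y \<in> V"
    and path_free: "rpath E V xs \<Longrightarrow> length xs < n"
    and card_V: "card V = m + n - 2" and even_m: "even m" and n: "3 \<le> n"
    and nm: "n + 1 \<le> m" "m \<le> 2 * n"
begin

lemma sym: "E x y \<Longrightarrow> E y x"
  using symp by (rule sympD)

lemma not_sym: "\<not> E x y \<Longrightarrow> \<not> E y x"
  using sym by blast

lemma cover: "H \<subseteq> V \<Longrightarrow> edge_cover (\<lambda>x y. \<not> E x y) E H"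
  using symp finite_subset[OF _ finite] by unfold_locales (auto simp: symp_def)

text \<open>If \<open>v\<close> is no hub, longest complement paths among its non-neighbours have
  less than \<open>m\<close> vertices. The vertices left outside then give a path of
  \<open>E\<close> on \<open>n\<close> vertices for odd \<open>n\<close>, but only on
  \<open>n - 1\<close> for even \<open>n\<close>; the rest of the proof analyses this extremal
  case.\<close>

lemma co_fan_low_degree:
  assumes v: "v \<in> V" and deg: "card {y. E v y} \<le> n div 2 - 1"
  shows "co_fan E V m"
proof (rule ccontr)
  assume no_fan: "\<not> co_fan E V m"
  let ?R = "\<lambda>x y. \<not> E x y"
  \<comment> \<open>For both parities the degree bound becomes \<open>n - d - 2\<close>, which
    leaves at least \<open>m + d - 1\<close> non-neighbours of \<open>v\<close>.\<close>
  define d where "d = (n - 1) div 2"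
  have d: "1 \<le> d" "n = 2 * d + 1 \<or> n = 2 * d + 2" using n unfolding d_def by presburger+
  have N: "{y. E v y} \<subseteq> V" using adj by auto
  then have fin_N: "finite {y. E v y}" by (rule finite_subset[OF _ finite])
  have "card (insert v {y. E v y}) = Suc (card {y. E v y})"
    using fin_N irrefl[of v] by simp
  moreover have "insert v {y. E v y} \<subseteq> V" using N v by simp
  ultimately have "card (V - insert v {y. E v y}) = m + n - 2 - Suc (card {y. E v y})"
    using card_Diff_subset[of "insert v {y. E v y}" V] fin_N card_V by simp
  moreover have "card {y. E v y} \<le> n - d - 2" using deg d by auto
  moreover have "d + 2 \<le> n" using d by linarith
  ultimately have "m + d - 1 \<le> card (V - insert v {y. E v y})" by linarith
  then obtain H where H: "H \<subseteq> V - insert v {y. E v y}" "card H = m + d - 1"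
    by (meson obtain_subset_with_card_n)
  then have HV: "H \<subseteq> V" "v \<notin> H" "\<And>x. x \<in> H \<Longrightarrow> \<not> E v x" by auto
  interpret edge_cover ?R E H using cover[OF HV(1)] .
  have no_red: "length xs < m" if "rpath ?R H xs" for xs
  proof (rule ccontr)
    assume "\<not> ?thesis"
    then have "rpath ?R (V - {v}) (take m xs)" "length (take m xs) = m"
      using rpath_mono[OF rpath_take[OF that], of "V - {v}"] HV(1,2) by auto
    moreover have "\<forall>q\<in>set (take m xs). \<not> E v q"
      using that HV(3) set_take_subset[of m xs] unfolding rpath_def by blast
    ultimately show False using no_fan v unfolding co_fan_def by blast
  qed
  obtain ps where ps: "longest_rpath ?R H ps" using longest_rpath_exists[OF finite_H] .
  obtain qs where qs: "longest_rpath E H qs" using longest_rpath_exists[OF finite_H] .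
  have l: "length qs < n" using qs rpath_mono[OF _ HV(1)] path_free by (simp add: longest_rpath_def)
  have k: "length ps < m" using ps no_red by (simp add: longest_rpath_def)
  have rest: "card (H - set ps) = m + d - 1 - length ps"
    using longest_rpath_card_diff[OF ps] H(2) by simp
  \<comment> \<open>Applied to \<open>qs\<close> for the cover bound, and in contrapositive form to
    \<open>ps\<close>. For odd \<open>n\<close> it is tight at \<open>x = 2 * d\<close>,
    \<open>m = 2 * d + 2\<close>; for even \<open>n\<close>, parity gives
    \<open>m \<ge> 2 * d + 4\<close>.\<close>
  have small: "x + x div 2 < card H" if "x < n" for x
  proof -
    have "n = 2 * d + 2 \<Longrightarrow> 2 * d + 4 \<le> m" using nm(1) even_m by presburger
    moreover have "x div 2 \<le> d" using that d(2) by auto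
    ultimately show ?thesis using that d nm(1) unfolding H(2) by linarith
  qed
  have "card H \<le> length ps + length ps div 2" by (rule cover_bound[OF ps qs small[OF l]])
  then have long: "n \<le> length ps"
    using small[of "length ps"] by linarith
  have "d \<le> card (H - set ps)" using rest k by simp
  then obtain Y where Y: "Y \<subseteq> H - set ps" "card Y = d"
    by (meson obtain_subset_with_card_n)
  have Y0: "Y \<noteq> {}" using Y d by auto
  have n_even: "n = 2 * d + 2"
  proof (rule ccontr)
    assume "\<not> ?thesis"
    then have "2 * card Y \<le> length ps" using d Y(2) long by auto
    then obtain xs where "rpath E H xs" "length xs = 2 * d + 1"
      using exists_odd_path[OF ps Y(1) Y0] Y(2) by metis
    then show False using path_free[of xs] rpath_mono[OF _ HV(1)] d \<open>n \<noteq> 2 * d + 2\<close> by fastforce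
  qed
  then obtain bs where bs: "rpath E (set ps \<union> Y) bs" "length bs = 2 * d + 1"
    "hd bs = hd ps" "last bs = last ps"
    using exists_path_between_ends[OF ps Y(1) Y0] Y(2) long by auto
  have ps_H: "set ps \<subseteq> H" "distinct ps" using ps by (simp_all add: longest_rpath_def rpath_def)
  have bs_V: "rpath E V bs" "set bs \<subseteq> H"
    using bs(1) ps_H(1) HV(1) Y(1) unfolding rpath_def by blast+
  have ps0: "ps \<noteq> []" "bs \<noteq> []" using long n bs(2) by auto
  \<comment> \<open>Since \<open>bs\<close> has \<open>n - 1\<close> vertices, it is a longest path
    of \<open>E\<close>, so all neighbours of its ends lie on it.\<close>
  have max: "length xs \<le> length bs" if "rpath E V xs" for xs
    using path_free[OF that] n_even bs(2) by simp
  have hd_nbr: "x \<in> set bs" if "E x (hd ps)" "x \<in> V" for x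
    using max[of "x # bs"] bs_V(1) that bs(3) by (auto simp: rpath_Cons)
  have last_nbr: "x \<in> set bs" if "E x (last ps)" "x \<in> V" for x
    using max[of "x # rev bs"] bs_V(1) that bs(4) rpath_rev[OF symp] by (auto simp: rpath_Cons hd_rev)
  \<comment> \<open>Every vertex of \<open>H\<close> outside \<open>ps\<close> is adjacent to
    \<open>hd ps\<close>, hence lies on \<open>bs\<close>, whose vertices come from
    \<open>ps\<close> and \<open>Y\<close>. Thus exactly \<open>d\<close> vertices are outside and
    \<open>ps\<close> has \<open>m - 1\<close> vertices.\<close>
  have HY: "H - set ps = Y"
  proof (rule ccontr)
    assume "\<not> ?thesis"
    then obtain y where y: "y \<in> H - set ps" "y \<notin> Y" using Y(1) by blast
    then have "y \<in> set bs" using outside_hd[OF ps, of y] HV(1) by (intro hd_nbr) auto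
    then show False using bs(1) y by (auto simp: rpath_def)
  qed
  have len: "length ps = m - 1" using rest Y(2) k unfolding HY by simp
  show False
  proof (cases "E (hd ps) (last ps)")
    case True
    \<comment> \<open>Now \<open>bs\<close> closes to a cycle of \<open>E\<close>, so the complement
      contains all pairs between \<open>set bs\<close> and \<open>D\<close>.\<close>
    define D where "D = H - set bs"
    have far: "\<not> E x u" if "x \<in> D" "u \<in> set bs" for x u
    proof -
      have "E (last bs) (hd bs)" using True sym bs(3,4) by simp
      then show ?thesis
        using rpath_cycle_closed[OF symp bs_V(1) _ max, of x u] that HV(1) unfolding D_def by blast
    qed
    have card_bs: "card (set bs) = 2 * d + 1"
      using bs(1,2) distinct_card by (fastforce simp: rpath_def)
    have card_D: "card D = m - d - 2"
      using bs_V(2) H(2) card_bs by (simp add: D_def card_Diff_subset)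
    have symp_R: "symp ?R" using symp by (auto simp: symp_def)
    have fin_D: "finite D" "D \<subseteq> H" using finite_H by (auto simp: D_def)
    show False
    proof (cases "m \<le> 4 * d + 2")
      case True
      have "\<not> E x y" if "x \<in> set bs" "y \<in> D" for x y
        by (rule not_sym[OF far[OF that(2,1)]])
      moreover have "m div 2 \<le> card (set bs)" "m div 2 \<le> card D"
        unfolding card_bs card_D using True nm(1) n_even by simp_all
      moreover have "set bs \<inter> D = {}" by (auto simp: D_def)
      ultimately obtain xs where xs: "rpath ?R (set bs \<union> D) xs" "length xs = 2 * (m div 2)"
        using rpath_between[OF finite_set fin_D(1) _ symp_R] by meson
      moreover have "rpath ?R H xs" using rpath_mono[OF xs(1)] bs_V(2) fin_D(2) by blast
      ultimately show False
        using no_red[of xs] even_m by simp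
    next
      case False
      then have m: "m = 4 * d + 4" using nm(2) n_even even_m by presburger
      \<comment> \<open>Here \<open>m = 2 * n\<close>, and alternating between the
        \<open>2 * d + 1\<close> vertices of \<open>bs\<close> and \<open>D\<close> is two vertices
        short. As \<open>D\<close> has \<open>3 * d + 2 \<ge> n\<close> vertices, it is no clique of
        \<open>E\<close>; a non-adjacent pair in it supplies the missing two.\<close>
      obtain e e' where e: "e \<in> D" "e' \<in> D" "e \<noteq> e'" "\<not> E e e'"
      proof (rule ccontr)
        assume "\<not> thesis"
        then have "E x y" if "x \<in> D" "y \<in> D" "x \<noteq> y" for x y
          using \<open>\<And>e' e. e \<in> D \<Longrightarrow> e' \<in> D \<Longrightarrow> e \<noteq> e' \<Longrightarrow> \<not> E e e' \<Longrightarrow> thesis\<close> that by blast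
        then obtain xs where "rpath E V xs" "length xs = card D"
          using rpath_of_clique[OF fin_D(1), of V E] fin_D(2) HV(1) by blast
        then show False using path_free[of xs] n_even m card_D by simp
      qed
      have "card (D - {e, e'}) = 3 * d" using e card_D m fin_D(1) by (simp add: card_Diff_subset)
      moreover have "\<not> E x y" if "x \<in> set bs" "y \<in> D - {e, e'}" for x y
        using that by (intro not_sym[OF far]) auto
      moreover have "2 * d + 1 \<le> card (set bs)" "2 * d + 1 \<le> 3 * d"
        using card_bs d(1) by simp_all
      moreover have "set bs \<inter> (D - {e, e'}) = {}" "finite (D - {e, e'})"
        using fin_D(1) by (auto simp: D_def)
      ultimately obtain xs where xs: "rpath ?R (set bs \<union> (D - {e, e'})) xs"
          "length xs = 2 * (2 * d + 1)" "hd xs \<in> set bs"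
        using rpath_between[OF finite_set _ _ symp_R, of "D - {e, e'}" bs "2 * d + 1"] by auto
      have "rpath ?R H xs" "e \<notin> set xs" "e' \<notin> set xs"
        using xs(1) e(1,2) fin_D(2) bs_V(2) by (auto simp: rpath_def D_def)
      moreover have "\<not> E e (hd xs)" using far e(1) xs(3) by blast
      moreover have "\<not> E e' e" by (rule not_sym[OF e(4)])
      ultimately have "rpath ?R H (e' # e # xs)"
        using e(1-3) fin_D(2) by (auto simp: rpath_Cons)
      then show False using no_red[of "e' # e # xs"] xs(2) m by simp
    qed
  next
    case False
    have ends: "hd ps \<in> set ps" "last ps \<in> set ps" using ps0 by simp_all
    \<comment> \<open>In this case \<open>ps\<close> closes to a cycle of the complement, and
      maximality excludes complement edges from it to \<open>Y\<close>.\<close>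
    have complete: "E y u" if "y \<in> Y" "u \<in> set ps" for y u
    proof -
      have "symp ?R" using symp by (auto simp: symp_def)
      moreover have "\<not> E (last ps) (hd ps)" by (rule not_sym[OF False])
      ultimately show ?thesis
        using rpath_cycle_closed[of ?R H ps y u] ps that Y(1) by (auto simp: longest_rpath_def)
    qed
    \<comment> \<open>An edge from \<open>hd ps\<close> to \<open>b\<close>, followed by
      \<open>2 * d\<close> vertices alternating between \<open>Y\<close> and the rest of
      \<open>ps\<close>, would be a path of \<open>E\<close> on \<open>n\<close> vertices.\<close>
    have hd_ps: "\<not> E (hd ps) b" if b: "b \<in> set ps" for b
    proof
      assume Eb: "E (hd ps) b"
      then have neq: "b \<noteq> hd ps" using irrefl by blast
      have "card (set ps - {hd ps, b}) = m - 3"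
        using neq b ends ps_H(2) len by (simp add: card_Diff_subset distinct_card)
      then have "d \<le> card (set ps - {hd ps, b})" using nm(1) n_even by simp
      moreover have "finite Y" "Y \<inter> (set ps - {hd ps, b}) = {}"
        using Y(1) finite_H finite_subset by blast+
      moreover have "E y u" if "y \<in> Y" "u \<in> set ps - {hd ps, b}" for y u
        using complete that by blast
      ultimately obtain xs where xs: "rpath E (Y \<union> (set ps - {hd ps, b})) xs"
          "length xs = 2 * d" "hd xs \<in> Y"
        using rpath_between[OF _ _ _ symp, of Y "set ps - {hd ps, b}" d] Y(2) d(1) by auto
      have "rpath E V xs" "hd ps \<notin> set xs" "b \<notin> set xs"
        using xs(1) Y(1) b ends ps_H(1) HV(1) by (auto simp: rpath_def)
      moreover have "E b (hd xs)" by (rule sym[OF complete[OF xs(3) b]])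
      ultimately have "rpath E V (hd ps # b # xs)"
        using Eb neq b ends ps_H(1) HV(1) by (auto simp: rpath_Cons)
      then show False using path_free[of "hd ps # b # xs"] xs(2) n_even by simp
    qed
    have "card (V - H) = d + 1"
      using card_V H(2) n_even HV(1) finite_H nm(1) by (simp add: card_Diff_subset)
    then have "card (V - H - {v}) = d" using v HV(2) by simp
    \<comment> \<open>The hub is now \<open>hd ps\<close>. Replacing it on \<open>ps\<close> by
      \<open>v\<close> at the front and adding \<open>w\<close> at the end gives \<open>m\<close>
      vertices; neither end of \<open>ps\<close> has a neighbour outside \<open>H\<close>.\<close>
    then obtain w where w: "w \<in> V" "w \<notin> H" "w \<noteq> v"
      using d(1) by (metis DiffE card.empty ex_in_conv insertI1 not_one_le_zero)
    obtain p ts where p: "ps = p # ts" "ts \<noteq> []" using long n by (cases ps; cases "tl ps"; auto)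
    have far: "\<not> E p x" "\<not> E (last ps) x" if "x \<in> V" "x \<notin> H" for x
      using hd_nbr[of x] last_nbr[of x] that bs_V(2) sym[of p x] sym[of "last ps" x] p(1) by auto
    have "rpath ?R H ts" "p \<notin> set ts" "set ts \<subseteq> H" "p \<in> H"
      using ps p by (auto simp: longest_rpath_def rpath_def successively_Cons)
    moreover from this have "\<not> E v (hd ts)" using hd_in_set[OF p(2)] HV(3) by blast
    ultimately have "rpath ?R (V - {p}) (v # ts @ [w])"
      using v w HV p far
      by (auto simp: rpath_def successively_Cons successively_append_iff hd_append)
    moreover have "\<forall>q\<in>set (v # ts @ [w]). \<not> E p q"
      using far(1) v w HV(2) hd_ps p(1) by auto
    moreover have "length (v # ts @ [w]) = m" using len p(1) nm(1) n by auto
    ultimately have "co_fan E V m"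
      unfolding co_fan_def using \<open>p \<in> H\<close> HV(1) by blast
    then show False using no_fan by blast
  qed
qed

section \<open>Components when all degrees are large\<close>

definition reach :: "'a \<Rightarrow> 'a set" where
  "reach v = {u. E\<^sup>*\<^sup>* v u}"

lemma reach_subset: "v \<in> V \<Longrightarrow> reach v \<subseteq> V"
proof
  fix u assume "v \<in> V" "u \<in> reach v"
  then have "E\<^sup>*\<^sup>* v u" by (simp add: reach_def)
  then show "u \<in> V" using \<open>v \<in> V\<close> by (induction) (auto intro: adj)
qed

lemma self_in_reach [simp]: "v \<in> reach v"
  by (simp add: reach_def)

lemma reach_eq: "u \<in> reach v \<Longrightarrow> reach u = reach v"
proof -
  have "symp E\<^sup>*\<^sup>*" using symp by (simp add: symp_rtranclp)
  then have "E\<^sup>*\<^sup>* x y \<Longrightarrow> E\<^sup>*\<^sup>* y x" for x y by (rule sympD)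
  then show "u \<in> reach v \<Longrightarrow> reach u = reach v"
    unfolding reach_def by (auto intro: rtranclp_trans)
qed

lemma adj_reach: "E x y \<Longrightarrow> reach x = reach y"
  by (rule reach_eq[symmetric]) (auto simp: reach_def)

lemma reach_disjoint: "y \<notin> reach x \<Longrightarrow> reach y \<inter> reach x = {}"
  using reach_eq self_in_reach by blast

text \<open>The hypothesis says that \<open>S\<close> is a union of components; it survives as
  components are peeled off in the counts below.\<close>

lemma closed_diff: "\<forall>x\<in>S. reach x \<subseteq> S \<Longrightarrow> \<forall>y\<in>S - reach x. reach y \<subseteq> S - reach x"
  using reach_disjoint by blast

lemma card_reach_diff:
  assumes "S \<subseteq> V" "\<forall>x\<in>S. reach x \<subseteq> S" "x \<in> S"
  shows "card (reach x) \<le> card S" "card (S - reach x) = card S - card (reach x)"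
proof -
  have "finite S" "reach x \<subseteq> S" using assms finite finite_subset by auto
  then show "card (reach x) \<le> card S" "card (S - reach x) = card S - card (reach x)"
    by (auto intro: card_mono simp: card_Diff_subset finite_subset)
qed

text \<open>Dirac's rotation argument: a longest path in a component spans a cycle, hence the component.\<close>

lemma card_reach:
  assumes v: "v \<in> V" and deg: "\<And>x. x \<in> V \<Longrightarrow> n div 2 \<le> card {y. E x y}"
  shows "card (reach v) < n"
proof -
  let ?C = "reach v"
  have CV: "?C \<subseteq> V" by (rule reach_subset[OF v])
  have fin: "finite ?C" using CV finite by (rule finite_subset)
  obtain ps where ps: "longest_rpath E ?C ps" using longest_rpath_exists[OF fin] .
  then have ps_path: "rpath E ?C ps" "distinct ps" "set ps \<subseteq> ?C" "successively E ps"
    by (auto simp: longest_rpath_def rpath_def)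
  have max: "length xs \<le> length ps" if "rpath E ?C xs" for xs
    using ps that by (simp add: longest_rpath_def)
  have ne: "ps \<noteq> []" using longest_rpath_nonempty[OF ps, of v] by simp
  define k where "k = length ps"
  have k: "0 < k" "k < n"
    using ne path_free rpath_mono[OF ps_path(1) CV] by (auto simp: k_def)
  have closed: "y \<in> ?C" if "E x y" "x \<in> ?C" for x y
    using that by (auto simp: reach_def intro: rtranclp.rtrancl_into_rtrancl)
  have hd_in: "hd ps \<in> ?C" "last ps \<in> ?C" using ne ps_path(3) by auto
  have nbr: "y \<in> set ps" if "E (hd ps) y \<or> E (last ps) y" for y
  proof (rule ccontr)
    assume y: "y \<notin> set ps"
    have "rpath E ?C (y # ps) \<or> rpath E ?C (y # rev ps)"
      using that y closed hd_in ps_path(1) rpath_rev[OF symp]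
      by (auto simp: rpath_Cons hd_rev intro: sym)
    then show False using max by fastforce
  qed
  \<comment> \<open>The shift makes an index in both sets mark two crossing chords, from
    \<open>hd ps\<close> to \<open>ps ! Suc i\<close> and from \<open>last ps\<close> to
    \<open>ps ! i\<close>.\<close>
  define I J where "I = {i. Suc i < k \<and> E (hd ps) (ps ! Suc i)}"
    and "J = {i. Suc i < k \<and> E (last ps) (ps ! i)}"
  have IJ: "I \<subseteq> {..<k - 1}" "J \<subseteq> {..<k - 1}" by (auto simp: I_def J_def)
  then have fin_IJ: "finite I" "finite J" using finite_subset by blast+
  have "{y. E (hd ps) y} \<subseteq> (\<lambda>i. ps ! Suc i) ` I"
  proof
    fix y assume y: "y \<in> {y. E (hd ps) y}"
    then obtain i where i: "i < k" "ps ! i = y" using nbr[of y] by (auto simp: in_set_conv_nth k_def)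
    then have "i \<noteq> 0" using y irrefl ne by (metis hd_conv_nth mem_Collect_eq)
    then obtain j where "i = Suc j" by (cases i) auto
    with i y show "y \<in> (\<lambda>i. ps ! Suc i) ` I" by (auto simp: I_def)
  qed
  then have I: "n div 2 \<le> card I"
    using order_trans[OF deg surj_card_le[OF fin_IJ(1)]] hd_in CV by blast
  have "{y. E (last ps) y} \<subseteq> (!) ps ` J"
  proof
    fix y assume y: "y \<in> {y. E (last ps) y}"
    then obtain i where i: "i < k" "ps ! i = y" using nbr[of y] by (auto simp: in_set_conv_nth k_def)
    then have "i \<noteq> k - 1" using y irrefl ne by (metis k_def last_conv_nth mem_Collect_eq)
    with i y show "y \<in> (!) ps ` J" by (auto simp: J_def)
  qed
  then have J: "n div 2 \<le> card J"
    using order_trans[OF deg surj_card_le[OF fin_IJ(2)]] hd_in CV by blast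
  \<comment> \<open>There are \<open>k - 1 \<le> n - 2\<close> positions, while
    \<open>2 * (n div 2) \<ge> n - 1\<close>.\<close>
  have "I \<inter> J \<noteq> {}"
  proof
    assume "I \<inter> J = {}"
    then have "card I + card J = card (I \<union> J)"
      using IJ by (simp add: card_Un_disjoint finite_subset)
    also have "\<dots> \<le> k - 1" using card_mono[of "{..<k - 1}" "I \<union> J"] IJ by simp
    finally show False using I J k by linarith
  qed
  then obtain i where i: "Suc i < k" "E (hd ps) (ps ! Suc i)" "E (last ps) (ps ! i)"
    by (auto simp: I_def J_def)
  define as bs where "as = take (Suc i) ps" and "bs = drop (Suc i) ps"
  have dec: "ps = as @ bs" by (simp add: as_def bs_def)
  have ab: "as \<noteq> []" "bs \<noteq> []" "last as = ps ! i" "hd bs = ps ! Suc i" "hd as = hd ps" "last bs = last ps"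
    using i(1) ne by (simp_all add: as_def bs_def k_def take_Suc_conv_app_nth hd_drop_conv_nth hd_append hd_conv_nth)
  \<comment> \<open>Reversing the second half uses one chord as an edge of the path and leaves the
    other to close it.\<close>
  define c where "c = as @ rev bs"
  have c: "rpath E ?C c" "E (last c) (hd c)" "set c = set ps" "length c = length ps"
    using ps_path(1) ab i(2,3) rpath_rev[OF symp] unfolding dec c_def
    by (auto simp: rpath_append last_rev hd_rev intro: sym)
  have "?C \<subseteq> set ps"
  proof
    fix u assume "u \<in> ?C"
    have "x \<in> set ps" if "E\<^sup>*\<^sup>* (hd ps) x" for x
      using that
    proof (induction)
      case base
      then show ?case using ne by simp
    next
      case (step y z)
      show ?case
      proof (rule ccontr)
        assume "z \<notin> set ps"
        moreover have "z \<in> ?C" using closed step.hyps(2) step.IH ps_path(3) by blast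
        ultimately have "\<not> E z y"
          using rpath_cycle_closed[OF symp c(1,2), of z y] max c(3,4) step.IH by auto
        then show False using sym step.hyps(2) by blast
      qed
    qed
    then show "u \<in> set ps" using reach_eq[OF hd_in(1)] \<open>u \<in> ?C\<close> unfolding reach_def by auto
  qed
  then have "card ?C \<le> length ps" using card_mono[of "set ps" ?C] card_length[of ps] by simp
  then show ?thesis using k by (simp add: k_def)
qed

text \<open>
  With all components small, the complement contains a complete multipartite graph; the hub is
  taken in a smallest component, and a longest path in the rest must alternate with one class.
\<close>

lemma co_fan_small_components:
  assumes small: "\<And>x. x \<in> V \<Longrightarrow> card (reach x) < n"
  shows "co_fan E V m"
proof (rule ccontr)
  assume no_fan: "\<not> co_fan E V m"
  let ?R = "\<lambda>x y. \<not> E x y"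
  have V0: "V \<noteq> {}" using card_V nm n by auto
  define h where "h = arg_min_on (\<lambda>x. card (reach x)) V"
  have h: "h \<in> V" "\<And>x. x \<in> V \<Longrightarrow> card (reach h) \<le> card (reach x)"
    using arg_min_if_finite[OF finite V0] arg_min_least[OF finite V0] unfolding h_def by auto
  define H where "H = V - reach h"
  have H: "H \<subseteq> V" "finite H" using finite by (auto simp: H_def)
  have H_h: "H \<subseteq> V - {h}" by (auto simp: H_def)
  have far: "\<not> E x y" if "reach x \<noteq> reach y" for x y
    using adj_reach that by blast
  have fin: "finite (reach x)" if "x \<in> V" for x
    using reach_subset[OF that] finite by (rule finite_subset)
  have no_red: "length xs < m" if "rpath ?R H xs" for xs
  proof (rule ccontr)
    assume "\<not> ?thesis"
    then have "rpath ?R (V - {h}) (take m xs)" "length (take m xs) = m"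
      using rpath_mono[OF rpath_take[OF that], of "V - {h}"] H_h by auto
    moreover have "\<not> E h q" if "q \<in> set (take m xs)" for q
    proof -
      have "q \<in> H" using that \<open>rpath ?R H xs\<close> set_take_subset[of m xs] by (auto simp: rpath_def)
      then show ?thesis by (auto simp: H_def reach_def)
    qed
    ultimately show False using no_fan h(1) unfolding co_fan_def by blast
  qed
  have card_H: "card H = m + n - 2 - card (reach h)"
    using card_Diff_subset[OF fin[OF h(1)] reach_subset[OF h(1)]] card_V by (simp add: H_def)
  have closed_H: "\<forall>x\<in>H. reach x \<subseteq> H"
    using closed_diff[of V h] reach_subset unfolding H_def by blast
  have m_H: "m \<le> card H"
  proof (cases "card (reach h) = n - 1")
    case False
    then show ?thesis using small[OF h(1)] card_H n by linarith
  next
    case True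
    \<comment> \<open>By minimality of \<open>reach h\<close> all components have
      \<open>n - 1\<close> vertices, and \<open>H\<close> has \<open>m - 1\<close>. After two
      components are removed from \<open>H\<close>, evenness forces \<open>m = 2 * n\<close>, and
      one vertex is left, too few for a third.\<close>
    have size: "card (reach x) = n - 1" if "x \<in> V" for x
      using small[OF that] h(2)[OF that] True by simp
    have "card H = m - 1" using True card_H nm n by simp
    then have card_H': "card H = m - 1" .
    then obtain x where x: "x \<in> H" using nm n H(2) by fastforce
    have Hx: "card (H - reach x) = m - n"
      using card_reach_diff[OF H(1) closed_H x] card_H' size[of x] x H(1) n by auto
    then have "card (H - reach x) \<noteq> 0" using nm by simp
    then obtain y where y: "y \<in> H - reach x" by (metis card.empty equals0I)
    have sub: "H - reach x \<subseteq> V" "H - reach x - reach y \<subseteq> V" using H(1) by auto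
    have "n - 1 \<le> m - n" "card (H - reach x - reach y) = m - n - (n - 1)"
      using card_reach_diff[OF sub(1) closed_diff[OF closed_H] y] Hx size[of y] y sub by auto
    moreover from this have "m = 2 * n" using nm n even_m by presburger
    ultimately have Hxy: "card (H - reach x - reach y) = 1" using n by simp
    then obtain z where z: "z \<in> H - reach x - reach y" by (metis card.empty equals0I zero_neq_one)
    have "n - 1 \<le> 1"
      using card_reach_diff(1)[OF sub(2) closed_diff[OF closed_diff[OF closed_H]] z] Hxy size[of z] z sub(2) by auto
    then show ?thesis using n by simp
  qed
  interpret edge_cover ?R E H using cover[OF H(1)] .
  obtain ps where ps: "longest_rpath ?R H ps" using longest_rpath_exists[OF H(2)] .
  define k where "k = length ps"
  have k: "k < m" using no_red ps by (simp add: longest_rpath_def k_def)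
  have "card (H - set ps) = card H - k" using longest_rpath_card_diff[OF ps] by (simp add: k_def)
  then have "card (H - set ps) \<noteq> 0" using k m_H by linarith
  then obtain y where y: "y \<in> H - set ps" by (metis card.empty equals0I)
  define A where "A = reach y"
  have dist: "distinct ps" and ps_H: "set ps \<subseteq> H" and ne: "ps \<noteq> []"
    using ps longest_rpath_nonempty[OF ps, of y] y by (auto simp: longest_rpath_def rpath_def)
  have in_A: "u \<in> A" if "E y u" for u
    using that by (auto simp: A_def reach_def)
  \<comment> \<open>A vertex outside \<open>ps\<close> is adjacent to \<open>hd ps\<close>, as is
    \<open>y\<close>, so it lies in the component \<open>A\<close> of \<open>y\<close>.\<close>
  have rest: "H - A \<subseteq> set ps"
  proof
    fix x assume x: "x \<in> H - A"
    show "x \<in> set ps"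
    proof (rule ccontr)
      assume "x \<notin> set ps"
      then have "E x (hd ps)" "E y (hd ps)" using outside_hd[OF ps] x y by auto
      then have "reach x = reach y" using adj_reach by metis
      then show False using x self_in_reach[of x] by (auto simp: A_def)
    qed
  qed
  \<comment> \<open>Positions of \<open>ps\<close> outside \<open>A\<close>: since \<open>y\<close>
    has neighbours only in \<open>A\<close>, they avoid both ends and are never consecutive, so
    there are at most \<open>(k - 1) / 2\<close> of them.\<close>
  define J where "J = {i. i < k \<and> ps ! i \<notin> A}"
  have ends: "0 \<notin> J" "k - 1 \<notin> J"
    using in_A[OF outside_hd[OF ps y]] in_A[OF outside_last[OF ps y]] ne
    by (auto simp: J_def k_def hd_conv_nth last_conv_nth)
  have consec: "i \<notin> J" if "Suc i \<in> J" for i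
    using outside_consecutive[OF ps y, of i] in_A that by (auto simp: J_def k_def)
  have "J \<union> Suc ` J \<subseteq> {1..k - 1}"
  proof -
    have "1 \<le> i" "i < k - 1" if "i \<in> J" for i
    proof -
      have "i < k" "i \<noteq> 0" "i \<noteq> k - 1" using that ends by (auto simp: J_def intro: gr0I)
      then show "1 \<le> i" "i < k - 1" by linarith+
    qed
    then show ?thesis by fastforce
  qed
  then have "card (J \<union> Suc ` J) \<le> k - 1" using card_mono[of "{1..k - 1}"] by fastforce
  moreover have "finite J" by (simp add: J_def)
  moreover from this have "card (J \<union> Suc ` J) = card J + card J"
    using consec by (subst card_Un_disjoint) (auto simp: card_image)
  moreover have "H - A \<subseteq> (!) ps ` J"
    using rest by (auto simp: J_def k_def in_set_conv_nth subset_iff image_iff)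
  ultimately have "2 * card (H - A) \<le> k - 1"
    using surj_card_le[of J "H - A" "(!) ps"] by linarith
  then have HA: "2 * card (H - A) \<le> m - 2" using k by linarith
  have yV: "y \<in> V" using y H(1) by blast
  have card_HA: "card (H - A) = m + n - 2 - card (reach h) - card A"
    using card_reach_diff[OF H(1) closed_H, of y] y card_H by (simp add: A_def)
  have le: "card (reach h) \<le> n - 1" "card A \<le> n - 1"
    using small[OF h(1)] small[OF yV] by (auto simp: A_def)
  show False
  proof (cases "H - A = {}")
    case True
    then have "card (H - A) = 0" by (metis card.empty)
    then show False using card_HA le nm n by linarith
  next
    case False
    then obtain z where z: "z \<in> H - A" by blast
    then have "card (reach z) \<le> card (H - A)"
      using card_reach_diff(1)[OF _ closed_diff[OF closed_H, where x = y], of z] H(1)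
      by (auto simp: A_def)
    \<comment> \<open>With \<open>c = card (H - A)\<close>, minimality gives
      \<open>card (reach h) \<le> c\<close>, hence \<open>2 * c \<ge> m - 1\<close>, against
      \<open>2 * c \<le> m - 2\<close>.\<close>
    moreover have "card (reach h) \<le> card (reach z)" using h(2)[of z] z H(1) by blast
    ultimately show False using card_HA HA le nm n by linarith
  qed
qed

lemma co_fan_exists: "co_fan E V m"
proof (cases "\<forall>x\<in>V. n div 2 \<le> card {y. E x y}")
  case True
  then show ?thesis using co_fan_small_components card_reach by blast
next
  case False
  then obtain v where "v \<in> V" "card {y. E v y} \<le> n div 2 - 1" by force
  then show ?thesis by (rule co_fan_low_degree)
qed

end

section \<open>Linear forests\<close>

definition consecutive :: "'a list \<Rightarrow> 'a \<Rightarrow> 'a \<Rightarrow> bool" where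
  "consecutive xs u v \<longleftrightarrow> (\<exists>as bs. xs = as @ u # v # bs \<or> xs = as @ v # u # bs)"

lemma consecutive_concat:
  assumes "consecutive xs u v" "xs \<in> set xss"
  shows "consecutive (concat xss) u v"
proof -
  obtain yss zss where xss: "xss = yss @ xs # zss" using assms(2) by (meson split_list)
  obtain as bs where "xs = as @ u # v # bs \<or> xs = as @ v # u # bs"
    using assms(1) unfolding consecutive_def by blast
  then have "concat xss = (concat yss @ as) @ u # v # (bs @ concat zss) \<or>
      concat xss = (concat yss @ as) @ v # u # (bs @ concat zss)"
    by (auto simp: xss)
  then show ?thesis unfolding consecutive_def by blast
qed

lemma consecutive_map_upt:
  assumes "Suc i < k"
  shows "consecutive (map f [0..<k]) (f i) (f (Suc i))" "consecutive (map f [0..<k]) (f (Suc i)) (f i)"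
proof -
  have "[0..<k] = [0..<i] @ [i..<k]"
    using assms upt_add_eq_append[of 0 i "k - i"] by simp
  also have "[i..<k] = i # Suc i # [Suc (Suc i)..<k]"
    using assms by (simp add: upt_conv_Cons)
  finally have "[0..<k] = [0..<i] @ i # Suc i # [Suc (Suc i)..<k]" .
  then have "map f [0..<k] = map f [0..<i] @ f i # f (Suc i) # map f [Suc (Suc i)..<k]"
    by (metis list.simps(9) map_append)
  then show "consecutive (map f [0..<k]) (f i) (f (Suc i))" "consecutive (map f [0..<k]) (f (Suc i)) (f i)"
    unfolding consecutive_def by blast+
qed

text \<open>By symmetry an edge is traversable both ways, so no edge leaves a strong component. The
  facts on arcs hold because components are induced subgraphs.\<close>

lemma component_partition:
  assumes "pair_graph F"
  shows "finite (components F)" "pverts F = (\<Union>C\<in>components F. verts C)"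
    and "C \<in> components F \<Longrightarrow> D \<in> components F \<Longrightarrow> C \<noteq> D \<Longrightarrow> verts C \<inter> verts D = {}"
    and "C \<in> components F \<Longrightarrow> (u, v) \<in> parcs F \<Longrightarrow> u \<in> verts C \<Longrightarrow> v \<in> verts C"
    and "C \<in> components F \<Longrightarrow> arcs C = {e \<in> parcs F. fst e \<in> verts C \<and> snd e \<in> verts C}"
    and "C \<in> components F \<Longrightarrow> tail C = fst \<and> head C = snd"
proof -
  interpret pair_graph F by fact
  have conv: "verts ` components F = scc_of ` pverts F"
    using sccs_verts_conv_scc_of sccs_verts_conv by (simp add: components_def)
  have inj: "inj_on verts (components F)"
    using inj_on_verts_sccs by (simp add: components_def)
  have "finite (verts ` components F)"
    unfolding conv by simp
  then show "finite (components F)" using inj by (rule finite_imageD)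
  have "(\<Union>x\<in>pverts F. scc_of x) = pverts F"
    using in_scc_of_self reachable_in_verts by (fastforce simp: scc_of_def)
  then show "pverts F = (\<Union>C\<in>components F. verts C)"
    unfolding conv[symmetric] by simp
  show "C \<in> components F \<Longrightarrow> D \<in> components F \<Longrightarrow> C \<noteq> D \<Longrightarrow> verts C \<inter> verts D = {}"
    using scc_disj by (simp add: components_def)
  show "v \<in> verts C" if C: "C \<in> components F" and uv: "(u, v) \<in> parcs F" "u \<in> verts C"
  proof -
    obtain x where x: "verts C = scc_of x" using C conv by blast
    have "(v, u) \<in> parcs F" using uv(1) pair_sym_arcs by (auto simp: symmetric_def dest: symD)
    then have "u \<rightarrow>\<^sup>*\<^bsub>with_proj F\<^esub> v" "v \<rightarrow>\<^sup>*\<^bsub>with_proj F\<^esub> u" using uv(1) by (auto intro!: reachable_adjI)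
    then show ?thesis using uv(2) unfolding x scc_of_def by (auto intro: reachable_trans)
  qed
  assume "C \<in> components F"
  then have "induced_subgraph C (with_proj F)" by (simp add: components_def sccs_def)
  then show "arcs C = {e \<in> parcs F. fst e \<in> verts C \<and> snd e \<in> verts C}" "tail C = fst \<and> head C = snd"
    by (auto simp: induced_subgraph_def subgraph_def compatible_def)
qed

text \<open>The list is pulled back along the isomorphism to \<open>path_graph k\<close>. That
  neighbours in the list are adjacent serves the vertex covers; that edges join neighbours in the
  list serves the embedding.\<close>

lemma component_list:
  assumes F: "linear_forest F" and C: "C \<in> components F"
  shows "\<exists>xs. distinct xs \<and> set xs = verts C \<and> successively (\<lambda>u v. (u, v) \<in> parcs F) xs \<and>
    (\<forall>u v. (u, v) \<in> parcs F \<and> u \<in> verts C \<longrightarrow> consecutive xs u v)"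
proof -
  have pg: "pair_graph F" using F by (simp add: linear_forest_def)
  note part = component_partition(4-6)[OF pg C]
  obtain k h where h: "pre_digraph.digraph_isomorphism C h"
      "with_proj (path_graph k) = app_iso h C"
    using F C by (auto simp: linear_forest_def digraph_iso_def)
  define f where "f = iso_verts h"
  have inj: "inj_on f (verts C)"
    using h(1) by (simp add: pre_digraph.digraph_isomorphism_def f_def)
  have img: "f ` verts C = {..<k}"
    using arg_cong[OF h(2), of verts] by (simp add: f_def path_graph_def)
  \<comment> \<open>An isomorphism carries its own tail and head maps; identifying them makes its
    arc map the one induced by \<open>f\<close>.\<close>
  have proj: "iso_tail h = fst" "iso_head h = snd"
    using arg_cong[OF h(2), of tail] arg_cong[OF h(2), of head] by simp_all
  have arc: "iso_arcs h (u, v) = (f u, f v)" if "(u, v) \<in> arcs C" for u v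
    using h(1) that proj part(3) by (auto simp: pre_digraph.digraph_isomorphism_def f_def prod_eq_iff)
  have arcs: "iso_arcs h ` arcs C = parcs (path_graph k)"
    using arg_cong[OF h(2), of arcs] by simp
  define g where "g = the_inv_into (verts C) f"
  have gf: "g (f u) = u" if "u \<in> verts C" for u
    using inj that by (simp add: g_def the_inv_into_f_f)
  have g: "bij_betw g {..<k} (verts C)"
    unfolding g_def using img inj by (metis bij_betw_the_inv_into inj_on_imp_bij_betw)
  define xs where "xs = map g [0..<k]"
  have "distinct xs" "set xs = verts C"
    using g by (auto simp: xs_def distinct_map bij_betw_def atLeast0LessThan)
  moreover have "successively (\<lambda>u v. (u, v) \<in> parcs F) xs"
    unfolding successively_conv_nth
  proof (intro allI impI)
    fix i assume i: "Suc i < length xs"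
    then have "(i, Suc i) \<in> iso_arcs h ` arcs C"
      unfolding arcs by (simp add: path_graph_def xs_def)
    then obtain u v where uv: "(u, v) \<in> arcs C" "iso_arcs h (u, v) = (i, Suc i)" by auto
    then have "f u = i" "f v = Suc i" using arc by auto
    moreover have "u \<in> verts C" "v \<in> verts C" "(u, v) \<in> parcs F" using uv(1) part(2) by auto
    ultimately have "g i = u" "g (Suc i) = v" using gf[of u] gf[of v] by auto
    then show "(xs ! i, xs ! Suc i) \<in> parcs F"
      using i \<open>(u, v) \<in> parcs F\<close> by (simp add: xs_def del: upt_Suc)
  qed
  moreover have "consecutive xs u v" if "(u, v) \<in> parcs F" "u \<in> verts C" for u v
  proof -
    have v: "v \<in> verts C" using part(1) that by blast
    then have "(u, v) \<in> arcs C" using that part(2) by auto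
    then have "(f u, f v) \<in> parcs (path_graph k)" using arcs arc by (metis imageI)
    then have "(Suc (f u) < k \<and> f v = Suc (f u)) \<or> (Suc (f v) < k \<and> f u = Suc (f v))"
      by (auto simp: path_graph_def)
    then show ?thesis
      using consecutive_map_upt[of _ k g] gf[OF that(2)] gf[OF v] unfolding xs_def by metis
  qed
  ultimately show ?thesis by blast
qed

text \<open>Lining up the components shows that \<open>F\<close> is a spanning subgraph of a path,
  so a fan over an \<open>m\<close>-vertex path suffices for the upper bound.\<close>

lemma linear_forest_list:
  assumes F: "linear_forest F"
  obtains xs where "distinct xs" "set xs = pverts F" "\<And>u v. (u, v) \<in> parcs F \<Longrightarrow> consecutive xs u v"
proof -
  have pg: "pair_graph F" using F by (simp add: linear_forest_def)
  note part = component_partition[OF pg]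
  obtain L where L: "\<And>C. C \<in> components F \<Longrightarrow> distinct (L C) \<and> set (L C) = verts C \<and>
      successively (\<lambda>u v. (u, v) \<in> parcs F) (L C) \<and>
      (\<forall>u v. (u, v) \<in> parcs F \<and> u \<in> verts C \<longrightarrow> consecutive (L C) u v)"
    using component_list[OF F] by metis
  obtain cs where cs: "set cs = components F" "distinct cs"
    using part(1) finite_distinct_list by blast
  have "distinct (concat (map L ds))" if "set ds \<subseteq> components F" "distinct ds" for ds
    using that
  proof (induction ds)
    case (Cons C ds)
    have "set (L C) \<inter> set (L D) = {}" if "D \<in> set ds" for D
    proof -
      have "C \<in> components F" "D \<in> components F" "C \<noteq> D" using that Cons.prems by auto
      then show ?thesis using part(3) L by simp
    qed
    then show ?case using Cons L by auto
  qed simp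
  then have "distinct (concat (map L cs))" using cs by blast
  moreover have "set (concat (map L cs)) = pverts F" using cs L part(2) by auto
  moreover have "consecutive (concat (map L cs)) u v" if "(u, v) \<in> parcs F" for u v
  proof -
    interpret pair_graph F by (rule pg)
    have "u \<in> pverts F" using that by (rule in_arcsD1)
    then obtain C where "C \<in> components F" "u \<in> verts C" using part(2) by blast
    then show ?thesis using L that cs(1) by (intro consecutive_concat[of "L C"]) auto
  qed
  ultimately show ?thesis using that by blast
qed

text \<open>Cutting the list into disjoint consecutive pairs, each pair contains a member of
  \<open>S\<close>; the induction removes one pair at a time.\<close>

lemma vertex_cover_list:
  assumes "successively (\<lambda>u v. u \<in> S \<or> v \<in> S) xs"
  shows "length xs div 2 \<le> length (filter (\<lambda>x. x \<in> S) xs)"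
  using assms by (induction xs rule: induct_list012) (auto simp: successively_Cons split: if_splits)

text \<open>The number \<open>q\<close> is the matching number of \<open>F\<close>, the sum of
  \<open>card (verts C) div 2\<close> over the components \<open>C\<close>; each component loses one
  vertex exactly when its order is odd.\<close>

lemma linear_forest_vertex_cover:
  assumes F: "linear_forest F"
  obtains q where "card (pverts F) = odd_components F + 2 * q"
    "\<And>S. S \<subseteq> pverts F \<Longrightarrow> (\<And>u v. (u, v) \<in> parcs F \<Longrightarrow> u \<in> S \<or> v \<in> S) \<Longrightarrow> q \<le> card S"
proof -
  have pg: "pair_graph F" using F by (simp add: linear_forest_def)
  note part = component_partition[OF pg]
  interpret pair_graph F by (rule pg)
  have fin: "finite (pverts F)" by (rule pair_finite_verts)
  have fin_C: "finite (verts C)" if "C \<in> components F" for C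
    using fin part(2) that by (metis UN_upper finite_subset)
  define q where "q = (\<Sum>C\<in>components F. card (verts C) div 2)"
  have "card (pverts F) = (\<Sum>C\<in>components F. card (verts C))"
    unfolding part(2) using part(1,3) fin_C by (intro card_UN_disjoint) auto
  also have "\<dots> = (\<Sum>C\<in>components F. card (verts C) mod 2 + 2 * (card (verts C) div 2))"
    by simp
  also have "\<dots> = (\<Sum>C\<in>components F. if odd (card (verts C)) then 1 else 0) + 2 * q"
    unfolding sum.distrib q_def sum_distrib_left by (auto simp: mod2_eq_if intro!: sum.cong)
  also have "(\<Sum>C\<in>components F. if odd (card (verts C)) then 1 else 0) = odd_components F"
    using part(1) by (simp add: odd_components_def sum.If_cases Int_def)
  finally have "card (pverts F) = odd_components F + 2 * q" .
  moreover have "q \<le> card S"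
    if S: "S \<subseteq> pverts F" "\<And>u v. (u, v) \<in> parcs F \<Longrightarrow> u \<in> S \<or> v \<in> S" for S
  proof -
    have "card (verts C) div 2 \<le> card (S \<inter> verts C)" if C: "C \<in> components F" for C
    proof -
      obtain xs where xs: "distinct xs" "set xs = verts C" "successively (\<lambda>u v. (u, v) \<in> parcs F) xs"
        using component_list[OF F C] by blast
      have "successively (\<lambda>u v. u \<in> S \<or> v \<in> S) xs"
        using xs(3) by (rule successively_mono) (use S(2) in blast)
      then have "length xs div 2 \<le> length (filter (\<lambda>x. x \<in> S) xs)" by (rule vertex_cover_list)
      moreover have "length (filter (\<lambda>x. x \<in> S) xs) = card (S \<inter> verts C)"
        using distinct_card[OF distinct_filter[OF xs(1)]] xs(2) by (metis Collect_conj_eq Int_commute Collect_mem_eq set_filter)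
      moreover have "length xs = card (verts C)" using distinct_card[OF xs(1)] xs(2) by simp
      ultimately show ?thesis by simp
    qed
    then have "q \<le> (\<Sum>C\<in>components F. card (S \<inter> verts C))"
      unfolding q_def by (rule sum_mono)
    also have "\<dots> = card (\<Union>C\<in>components F. S \<inter> verts C)"
    proof (rule card_UN_disjoint[symmetric, OF part(1)])
      show "\<forall>C\<in>components F. finite (S \<inter> verts C)" using fin_C by auto
      show "\<forall>C\<in>components F. \<forall>D\<in>components F. C \<noteq> D \<longrightarrow> (S \<inter> verts C) \<inter> (S \<inter> verts D) = {}"
        using part(3) by blast
    qed
    also have "(\<Union>C\<in>components F. S \<inter> verts C) = S" using S(1) part(2) by blast
    finally show ?thesis .
  qed
  ultimately show ?thesis using that by blast
qed

section \<open>Ramsey numbers\<close>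

lemma co_fan_mono:
  assumes "co_fan E V k" "m \<le> k"
  shows "co_fan E V m"
proof -
  obtain h qs where h: "h \<in> V" "rpath (\<lambda>x y. \<not> E x y) (V - {h}) qs" "length qs = k"
    "\<forall>q\<in>set qs. \<not> E h q"
    using assms(1) unfolding co_fan_def by blast
  have "\<forall>q\<in>set (take m qs). \<not> E h q" using h(4) set_take_subset[of m qs] by blast
  then show ?thesis
    unfolding co_fan_def using h(1,3) rpath_take[OF h(2), of m] assms(2)
    by (intro exI[of _ h] exI[of _ "take m qs"]) simp
qed

text \<open>For \<open>n = 2\<close> there are four vertices and no edges. Otherwise
  \<open>m\<close> is rounded up to the even \<open>m + pa m\<close>, and the fan obtained is
  shortened.\<close>

lemma co_fan_if_path_free:
  assumes E: "symp E" "\<And>x. \<not> E x x" "\<And>x y. E x y \<Longrightarrow> y \<in> V"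
    and V: "finite V" "card V = m + n - 2 + pa m"
    and path_free: "\<And>xs. rpath E V xs \<Longrightarrow> length xs < n"
    and nm: "2 \<le> n" "n + 1 \<le> m" "m \<le> 2 * n - 1"
  shows "co_fan E V m"
proof (cases "n = 2")
  case True
  then have m: "m = 3" using nm by simp
  then have card: "card V = 4" using V(2) True by (simp add: pa_def)
  then obtain h where h: "h \<in> V" by fastforce
  have no_edge: "\<not> E x y" for x y
  proof
    assume "E x y"
    moreover from this have "E y x" using E(1) by (rule sympD[rotated])
    ultimately have "rpath E V [x, y]"
      using E(2,3) by (auto simp: rpath_def)
    then show False using path_free True by fastforce
  qed
  obtain qs where "rpath (\<lambda>x y. \<not> E x y) (V - {h}) qs" "length qs = card (V - {h})"
    using rpath_of_clique[of "V - {h}" "V - {h}" "\<lambda>x y. \<not> E x y"] V(1) no_edge by blast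
  then show ?thesis
    unfolding co_fan_def using h no_edge m card by (intro exI[of _ h] exI[of _ qs]) simp
next
  case False
  interpret path_free E V n "m + pa m"
    using assms False by unfold_locales (auto simp: pa_def split: if_splits)
  show ?thesis using co_fan_exists by (rule co_fan_mono) simp
qed

lemma contains_copy_path_graph:
  assumes G: "pair_graph G" and xs: "rpath (\<lambda>u v. (u, v) \<in> parcs G) (pverts G) xs" "n \<le> length xs"
  shows "contains_copy G (path_graph n)"
proof -
  interpret pair_graph G by (rule G)
  have sym: "(v, u) \<in> parcs G" if "(u, v) \<in> parcs G" for u v
    using that pair_sym_arcs by (auto simp: symmetric_def dest: symD)
  have dist: "distinct xs" and sub: "set xs \<subseteq> pverts G"
    and adj: "\<And>i. Suc i < length xs \<Longrightarrow> (xs ! i, xs ! Suc i) \<in> parcs G"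
    using xs(1) by (auto simp: rpath_def successively_conv_nth)
  show ?thesis
    unfolding contains_copy_iff[OF G pair_graph_path_graph]
  proof (intro exI[of _ "(!) xs"] conjI)
    show "inj_on ((!) xs) (pverts (path_graph n))"
      using dist xs(2) by (auto simp: path_graph_def inj_on_def nth_eq_iff_index_eq)
    have "xs ! i \<in> set xs" if "i < n" for i
      using that xs(2) by simp
    then show "(!) xs ` pverts (path_graph n) \<subseteq> pverts G"
      using sub by (auto simp: path_graph_def)
    show "\<forall>(u, v)\<in>parcs (path_graph n). (xs ! u, xs ! v) \<in> parcs G"
      using adj sym xs(2) by (auto simp: path_graph_def)
  qed
qed

lemma consecutive_nthE:
  assumes "consecutive xs u v"
  obtains i where "Suc i < length xs" "u = xs ! i \<and> v = xs ! Suc i \<or> v = xs ! i \<and> u = xs ! Suc i"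
proof -
  obtain as bs where "xs = as @ u # v # bs \<or> xs = as @ v # u # bs"
    using assms unfolding consecutive_def by blast
  then show ?thesis using that[of "length as"] by (auto simp: nth_append)
qed

lemma contains_copy_cone:
  assumes G: "pair_graph G" and F: "linear_forest F"
    and fan: "co_fan (\<lambda>u v. (u, v) \<in> parcs G) (pverts G) (card (pverts F))"
  shows "contains_copy (graph_complement G) (cone F)"
proof -
  let ?E = "\<lambda>u v. (u, v) \<in> parcs G"
  interpret pair_graph G by (rule G)
  have pF: "pair_graph F" using F by (simp add: linear_forest_def)
  have sym: "(v, u) \<in> parcs G" if "(u, v) \<in> parcs G" for u v
    using that pair_sym_arcs by (auto simp: symmetric_def dest: symD)
  obtain h qs where h: "h \<in> pverts G" "rpath (\<lambda>u v. \<not> ?E u v) (pverts G - {h}) qs"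
      "length qs = card (pverts F)" "\<forall>q\<in>set qs. \<not> ?E h q"
    using fan unfolding co_fan_def by blast
  obtain xs where xs: "distinct xs" "set xs = pverts F" "\<And>u v. (u, v) \<in> parcs F \<Longrightarrow> consecutive xs u v"
    using linear_forest_list[OF F] by blast
  have len: "length xs = length qs" using h(3) xs(1,2) distinct_card by fastforce
  define idx where "idx = the_inv_into {..<length xs} ((!) xs)"
  have idx_nth: "idx (xs ! i) = i" if "i < length xs" for i
    using that xs(1) unfolding idx_def by (intro the_inv_into_f_f) (auto simp: inj_on_def nth_eq_iff_index_eq)
  have idx: "idx x < length qs \<and> xs ! idx x = x" if "x \<in> pverts F" for x
    using that idx_nth xs(2) len by (metis in_set_conv_nth)
  have qs: "distinct qs" "set qs \<subseteq> pverts G - {h}"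
      "\<And>i. Suc i < length qs \<Longrightarrow> \<not> ?E (qs ! i) (qs ! Suc i)"
    using h(2) by (auto simp: rpath_def successively_conv_nth)
  \<comment> \<open>The new vertex goes to the hub, and each vertex of \<open>F\<close> to the
    vertex of \<open>qs\<close> at its position in \<open>xs\<close>.\<close>
  define f where "f = case_option h (\<lambda>x. qs ! idx x)"
  have f_None: "f None = h" by (simp add: f_def)
  have f_in: "f (Some x) \<in> set qs" if "x \<in> pverts F" for x
    using idx[OF that] by (simp add: f_def)
  have f_inj: "x = y" if "x \<in> pverts F" "y \<in> pverts F" "f (Some x) = f (Some y)" for x y
  proof -
    have "qs ! idx x = qs ! idx y" using that(3) by (simp add: f_def)
    then have "idx x = idx y"
      using idx[OF that(1)] idx[OF that(2)] nth_eq_iff_index_eq[OF qs(1), of "idx x" "idx y"] by blast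
    then show ?thesis using idx[OF that(1)] idx[OF that(2)] by metis
  qed
  have hub: "(h, q) \<in> parcs (graph_complement G)" "(q, h) \<in> parcs (graph_complement G)"
    if "q \<in> set qs" for q
  proof -
    have "q \<in> pverts G" "q \<noteq> h" "(h, q) \<notin> parcs G" "(q, h) \<notin> parcs G"
      using that h(4) qs(2) sym[of q h] by blast+
    then show "(h, q) \<in> parcs (graph_complement G)" "(q, h) \<in> parcs (graph_complement G)"
      using h(1) by (simp_all add: graph_complement_def)
  qed
  have edge: "(f (Some u), f (Some v)) \<in> parcs (graph_complement G)" if uv: "(u, v) \<in> parcs F" for u v
  proof -
    interpret F: pair_graph F by (rule pF)
    have in_F: "u \<in> pverts F" "v \<in> pverts F" "u \<noteq> v"
      using F.in_arcsD1[OF uv] F.in_arcsD2[OF uv] F.no_loops' uv by blast+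
    obtain i where i: "Suc i < length xs" "u = xs ! i \<and> v = xs ! Suc i \<or> v = xs ! i \<and> u = xs ! Suc i"
      using xs(3)[OF uv] by (rule consecutive_nthE)
    have "\<not> ?E (f (Some u)) (f (Some v))"
      using i idx_nth[of i] idx_nth[of "Suc i"] qs(3)[of i] sym[of "qs ! Suc i" "qs ! i"] len
      by (auto simp: f_def)
    moreover have "f (Some u) \<noteq> f (Some v)" using f_inj in_F by blast
    ultimately show ?thesis
      using f_in[OF in_F(1)] f_in[OF in_F(2)] qs(2) by (auto simp: graph_complement_def)
  qed
  show ?thesis
    unfolding contains_copy_iff[OF pair_graph_graph_complement[OF G] pair_graph_cone[OF pF]]
  proof (intro exI[of _ f] conjI)
    have "f (Some x) \<noteq> h" if "x \<in> pverts F" for x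
      using f_in[OF that] qs(2) by blast
    then show "inj_on f (pverts (cone F))"
      using f_inj f_None by (fastforce simp: cone_def inj_on_def)
    have "f (Some x) \<in> pverts G" if "x \<in> pverts F" for x
      using f_in[OF that] qs(2) by blast
    then show "f ` pverts (cone F) \<subseteq> pverts (graph_complement G)"
      using h(1) f_None by (auto simp: cone_def graph_complement_def)
    have "(f a, f b) \<in> parcs (graph_complement G)" if "(a, b) \<in> parcs (cone F)" for a b
    proof -
      from that consider u v where "a = Some u" "b = Some v" "(u, v) \<in> parcs F"
        | v where "a = None" "b = Some v" "v \<in> pverts F"
        | v where "a = Some v" "b = None" "v \<in> pverts F"
        by (auto simp: cone_def)
      then show ?thesis
        by cases (simp_all add: edge hub f_in f_None)
    qed
    then show "\<forall>(u, v)\<in>parcs (cone F). (f u, f v) \<in> parcs (graph_complement G)"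
      by blast
  qed
qed

lemma ramsey_property:
  fixes F :: "'a pair_pre_digraph" and G :: "'b pair_pre_digraph"
  assumes G: "pair_graph G" "card (pverts G) = m + n - 2 + pa m"
    and F: "linear_forest F" "card (pverts F) = m"
    and nm: "2 \<le> n" "n + 1 \<le> m" "m \<le> 2 * n - 1"
  shows "contains_copy G (path_graph n) \<or> contains_copy (graph_complement G) (cone F)"
proof (rule disjCI)
  assume "\<not> contains_copy (graph_complement G) (cone F)"
  then have no_fan: "\<not> co_fan (\<lambda>u v. (u, v) \<in> parcs G) (pverts G) m"
    using contains_copy_cone[OF G(1) F(1)] F(2) by blast
  interpret pair_graph G by (rule G(1))
  have "\<exists>xs. rpath (\<lambda>u v. (u, v) \<in> parcs G) (pverts G) xs \<and> n \<le> length xs"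
  proof (rule ccontr)
    assume "\<not> ?thesis"
    then have short: "length xs < n" if "rpath (\<lambda>u v. (u, v) \<in> parcs G) (pverts G) xs" for xs
      using that not_le by blast
    have "symp (\<lambda>u v. (u, v) \<in> parcs G)"
      using pair_sym_arcs by (simp add: symmetric_def symp_def sym_def)
    then have "co_fan (\<lambda>u v. (u, v) \<in> parcs G) (pverts G) m"
      by (rule co_fan_if_path_free[OF _ _ in_arcsD2 pair_finite_verts G(2) short nm])
        (use no_loops' in blast)
    then show False using no_fan by blast
  qed
  then show "contains_copy G (path_graph n)"
    using contains_copy_path_graph[OF G(1)] by blast
qed

section \<open>Lower bounds from disjoint unions of cliques\<close>

definition disjoint_cliques :: "(nat \<Rightarrow> nat) \<Rightarrow> nat \<Rightarrow> nat pair_pre_digraph" where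
  "disjoint_cliques c r = \<lparr>pverts = {..<r}, parcs = {(u, v). u < r \<and> v < r \<and> u \<noteq> v \<and> c u = c v}\<rparr>"

lemma pair_graph_disjoint_cliques: "pair_graph (disjoint_cliques c r)"
  by (rule pair_graphI) (auto simp: disjoint_cliques_def)

lemma path_in_disjoint_cliques:
  assumes "contains_copy (disjoint_cliques c r) (path_graph n)"
  obtains j where "n \<le> card {u \<in> {..<r}. c u = j}"
proof -
  obtain f where f: "inj_on f (pverts (path_graph n))"
      "f ` pverts (path_graph n) \<subseteq> pverts (disjoint_cliques c r)"
      "\<forall>(u, v)\<in>parcs (path_graph n). (f u, f v) \<in> parcs (disjoint_cliques c r)"
    using assms unfolding contains_copy_iff[OF pair_graph_disjoint_cliques pair_graph_path_graph]
    by blast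
  have step: "c (f i) = c (f (Suc i))" if "Suc i < n" for i
    using bspec[OF f(3), of "(i, Suc i)"] that by (auto simp: disjoint_cliques_def path_graph_def)
  have inj: "inj_on f {..<n}" and sub: "f ` {..<n} \<subseteq> {..<r}"
    using f(1,2) by (simp_all add: disjoint_cliques_def path_graph_def)
  have "i < n \<Longrightarrow> c (f i) = c (f 0)" for i
    by (induction i) (simp_all add: step[symmetric])
  then have "f ` {..<n} \<subseteq> {u \<in> {..<r}. c u = c (f 0)}" using sub by auto
  then have "card (f ` {..<n}) \<le> card {u \<in> {..<r}. c u = c (f 0)}" by (intro card_mono) auto
  then show ?thesis using that card_image[OF inj] by simp
qed

lemma cone_in_complement_disjoint_cliques:
  assumes F: "pair_graph F" and "contains_copy (graph_complement (disjoint_cliques c r)) (cone F)"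
  obtains h g where "h < r" "inj_on g (pverts F)" "g ` pverts F \<subseteq> {u \<in> {..<r}. c u \<noteq> c h}"
    "\<And>u v. (u, v) \<in> parcs F \<Longrightarrow> c (g u) \<noteq> c (g v)"
proof -
  let ?G = "graph_complement (disjoint_cliques c r)"
  obtain f where f: "inj_on f (pverts (cone F))" "f ` pverts (cone F) \<subseteq> pverts ?G"
      "\<forall>(u, v)\<in>parcs (cone F). (f u, f v) \<in> parcs ?G"
    using assms(2) unfolding contains_copy_iff[OF pair_graph_graph_complement[OF
          pair_graph_disjoint_cliques] pair_graph_cone[OF F]]
    by blast
  have verts: "pverts ?G = {..<r}" by (simp add: graph_complement_def disjoint_cliques_def)
  have edge: "c (f u) \<noteq> c (f v)" if "(u, v) \<in> parcs (cone F)" for u v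
    using bspec[OF f(3) that] by (auto simp: graph_complement_def disjoint_cliques_def)
  show ?thesis
  proof (rule that[of "f None" "f \<circ> Some"])
    show "f None < r" using f(2) verts by (auto simp: cone_def)
    show "inj_on (f \<circ> Some) (pverts F)"
      using f(1) by (auto simp: cone_def inj_on_def)
    show "(f \<circ> Some) ` pverts F \<subseteq> {u \<in> {..<r}. c u \<noteq> c (f None)}"
    proof clarify
      fix x assume x: "x \<in> pverts F"
      then have "f (Some x) < r" using f(2) verts by (auto simp: cone_def)
      moreover have "(Some x, None) \<in> parcs (cone F)" using x by (simp add: cone_def)
      ultimately show "(f \<circ> Some) x \<in> {..<r} \<and> c ((f \<circ> Some) x) \<noteq> c (f None)"
        using edge by simp
    qed
    show "c ((f \<circ> Some) u) \<noteq> c ((f \<circ> Some) v)" if "(u, v) \<in> parcs F" for u v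
      using edge[of "Some u" "Some v"] that by (auto simp: cone_def)
  qed
qed

text \<open>The assumption \<open>ex\<close> guarantees that the least number in
  \<open>ramsey_number\<close> is attained. If it were some \<open>r \<le> N\<close>, the colouring
  \<open>c\<close> restricted to the first \<open>r\<close> vertices would still have small classes
  and no cone in the complement.\<close>

lemma ramsey_number_gt:
  fixes F :: "'a pair_pre_digraph" and c :: "nat \<Rightarrow> nat"
  assumes F: "pair_graph F"
    and ex: "\<And>G :: nat pair_pre_digraph. pair_graph G \<Longrightarrow> card (pverts G) = M \<Longrightarrow>
      contains_copy G (path_graph n) \<or> contains_copy (graph_complement G) (cone F)"
    and small: "\<And>j. card {u \<in> {..<N}. c u = j} < n"
    and no_cone: "\<And>h g. h < N \<Longrightarrow> inj_on g (pverts F) \<Longrightarrow> g ` pverts F \<subseteq> {u \<in> {..<N}. c u \<noteq> c h} \<Longrightarrow>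
      (\<And>u v. (u, v) \<in> parcs F \<Longrightarrow> c (g u) \<noteq> c (g v)) \<Longrightarrow> False"
  shows "N < ramsey_number (path_graph n) (cone F)"
proof (rule ccontr)
  define r where "r = ramsey_number (path_graph n) (cone F)"
  assume "\<not> ?thesis"
  then have r: "{..<r} \<subseteq> {..<N}" by (auto simp: r_def)
  have "\<forall>G :: nat pair_pre_digraph. pair_graph G \<and> card (pverts G) = r \<longrightarrow>
      contains_copy G (path_graph n) \<or> contains_copy (graph_complement G) (cone F)"
    unfolding r_def ramsey_number_def by (rule LeastI[of _ M]) (use ex in blast)
  moreover have "card (pverts (disjoint_cliques c r)) = r" by (simp add: disjoint_cliques_def)
  ultimately consider "contains_copy (disjoint_cliques c r) (path_graph n)"
    | "contains_copy (graph_complement (disjoint_cliques c r)) (cone F)"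
    using pair_graph_disjoint_cliques by blast
  then show False
  proof cases
    case 1
    then obtain j where "n \<le> card {u \<in> {..<r}. c u = j}" by (rule path_in_disjoint_cliques)
    also have "\<dots> \<le> card {u \<in> {..<N}. c u = j}" using r by (intro card_mono) auto
    finally show False using small[of j] by simp
  next
    case 2
    then obtain h g where "h < r" "inj_on g (pverts F)" "g ` pverts F \<subseteq> {u \<in> {..<r}. c u \<noteq> c h}"
      "\<And>u v. (u, v) \<in> parcs F \<Longrightarrow> c (g u) \<noteq> c (g v)"
      using cone_in_complement_disjoint_cliques[OF F] by blast
    then show False using r by (intro no_cone[of h g]) auto
  qed
qed

text \<open>Colouring of consecutive intervals of lengths \<open>a\<close> and \<open>b\<close> and
  a third one taking the remaining vertices.\<close>

definition block :: "nat \<Rightarrow> nat \<Rightarrow> nat \<Rightarrow> nat" where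
  "block a b u = (if u < a then 0 else if u < a + b then 1 else 2)"

lemma card_block:
  "card {u \<in> {..<a + b + d}. block a b u = 0} = a"
  "card {u \<in> {..<a + b + d}. block a b u = 1} = b"
  "card {u \<in> {..<a + b + d}. block a b u = 2} = d"
  "card {u \<in> {..<a + b + d}. block a b u \<noteq> 0} = b + d"
  "card {u \<in> {..<a + b + d}. block a b u \<noteq> 1} = a + d"
  "card {u \<in> {..<a + b + d}. block a b u \<noteq> 2} = a + b"
proof -
  have "{u \<in> {..<a + b + d}. block a b u = 0} = {..<a}"
    "{u \<in> {..<a + b + d}. block a b u = 1} = {a..<a + b}"
    "{u \<in> {..<a + b + d}. block a b u = 2} = {a + b..<a + b + d}"
    "{u \<in> {..<a + b + d}. block a b u \<noteq> 0} = {a..<a + b + d}"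
    "{u \<in> {..<a + b + d}. block a b u \<noteq> 1} = {..<a} \<union> {a + b..<a + b + d}"
    "{u \<in> {..<a + b + d}. block a b u \<noteq> 2} = {..<a + b}"
    by (auto simp: block_def)
  moreover have "card ({..<a} \<union> {a + b..<a + b + d}) = a + d"
    by (subst card_Un_disjoint) auto
  ultimately show "card {u \<in> {..<a + b + d}. block a b u = 0} = a"
    "card {u \<in> {..<a + b + d}. block a b u = 1} = b"
    "card {u \<in> {..<a + b + d}. block a b u = 2} = d"
    "card {u \<in> {..<a + b + d}. block a b u \<noteq> 0} = b + d"
    "card {u \<in> {..<a + b + d}. block a b u \<noteq> 1} = a + d"
    "card {u \<in> {..<a + b + d}. block a b u \<noteq> 2} = a + b"
    by simp_all
qed

lemma block_induct: "P 0 \<Longrightarrow> P 1 \<Longrightarrow> P 2 \<Longrightarrow> P (block a b u)"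
  by (simp add: block_def)

lemma card_block_less:
  assumes "a < n" "b < n" "d < n"
  shows "card {u \<in> {..<a + b + d}. block a b u = j} < n"
proof (cases "j \<in> {0, 1, 2}")
  case True
  then show ?thesis using assms card_block[of a b d] by auto
next
  case False
  then have "{u \<in> {..<a + b + d}. block a b u = j} = {}" by (auto simp: block_def)
  then show ?thesis using assms by (metis card.empty gr_zeroI not_less_zero)
qed

theorem theorem4:
  fixes n m :: nat and F :: "'a pair_pre_digraph"
  assumes "2 \<le> n" and "n + 1 \<le> m" and "m \<le> 2 * n - 1"
    and "linear_forest F" and "parcs F \<noteq> {}" and "card (pverts F) = m"
  shows "int (ramsey_number (path_graph n) (cone F)) \<le> int m + int n - 2 + int (pa m) \<and>
    int (ramsey_number (path_graph n) (cone F)) \<ge>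
      Max {2 * int n - 1, \<lceil>3 * real m / 2\<rceil> - 1, int m + int n - int (odd_components F) - 2}"
proof -
  define r where "r = ramsey_number (path_graph n) (cone F)"
  have pF: "pair_graph F" using assms(4) by (simp add: linear_forest_def)
  have ex: "contains_copy G (path_graph n) \<or> contains_copy (graph_complement G) (cone F)"
    if "pair_graph G" "card (pverts G) = m + n - 2 + pa m" for G :: "nat pair_pre_digraph"
    by (rule ramsey_property[OF that assms(4,6,1-3)])
  have upper: "r \<le> m + n - 2 + pa m"
    unfolding r_def ramsey_number_def by (rule Least_le) (use ex in blast)
  note gt = ramsey_number_gt[OF pF ex, folded r_def]
  have many: False
    if "inj_on g (pverts F)" "g ` pverts F \<subseteq> A" "finite A" "card A < m" for g :: "'a \<Rightarrow> nat" and A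
    using card_inj_on_le[OF that(1-3)] that(4) assms(6) by simp
  \<comment> \<open>Two cliques of order \<open>n - 1\<close>: with the hub in one of them, all of
    \<open>F\<close> would lie in the other, which spans no edge of the complement.\<close>
  have lower1: "2 * n - 2 < r"
  proof -
    let ?c = "block (n - 1) (n - 1)"
    have "(n - 1) + (n - 1) + 0 < r"
    proof (rule gt[of _ _ ?c])
      show "card {u \<in> {..<n - 1 + (n - 1) + 0}. ?c u = j} < n" for j
        using assms(1) by (intro card_block_less) auto
    next
      fix h g assume h: "h < n - 1 + (n - 1) + 0"
        and g: "g ` pverts F \<subseteq> {u \<in> {..<n - 1 + (n - 1) + 0}. ?c u \<noteq> ?c h}"
          "\<And>u v. (u, v) \<in> parcs F \<Longrightarrow> ?c (g u) \<noteq> ?c (g v)"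
      obtain u v where uv: "(u, v) \<in> parcs F" using assms(5) by auto
      interpret pair_graph F by (rule pF)
      have "g u \<in> {u \<in> {..<n - 1 + (n - 1) + 0}. ?c u \<noteq> ?c h}"
          "g v \<in> {u \<in> {..<n - 1 + (n - 1) + 0}. ?c u \<noteq> ?c h}"
        using g(1) in_arcsD1[OF uv] in_arcsD2[OF uv] by blast+
      then have "?c (g u) = ?c (g v)" using h by (auto simp: block_def split: if_splits)
      then show False using g(2)[OF uv] by simp
    qed
    then show ?thesis by simp
  qed
  \<comment> \<open>As \<open>m div 2 + (m - 1) div 2 = m - 1\<close>, any two of the three cliques
    are too small to hold \<open>F\<close>.\<close>
  have lower2: "m div 2 + (m - 1) div 2 + (m - 1) div 2 < r"
  proof (rule gt[of _ _ "block (m div 2) ((m - 1) div 2)"])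
    show "card {u \<in> {..<m div 2 + (m - 1) div 2 + (m - 1) div 2}.
        block (m div 2) ((m - 1) div 2) u = j} < n" for j
      by (rule card_block_less) (use assms(1-3) in linarith)+
  next
    let ?c = "block (m div 2) ((m - 1) div 2)"
    let ?A = "\<lambda>j. {u \<in> {..<m div 2 + (m - 1) div 2 + (m - 1) div 2}. ?c u \<noteq> j}"
    fix h g assume g: "inj_on g (pverts F)" "g ` pverts F \<subseteq> ?A (?c h)"
    have "card (?A 0) < m" "card (?A 1) < m" "card (?A 2) < m"
      unfolding card_block using assms(2) by linarith+
    then have "card (?A (?c h)) < m"
      by (rule block_induct[where P = "\<lambda>j. card (?A j) < m"])
    then show False by (intro many[OF g]) auto
  qed
  obtain q where q: "m = odd_components F + 2 * q"
    "\<And>S. S \<subseteq> pverts F \<Longrightarrow> (\<And>u v. (u, v) \<in> parcs F \<Longrightarrow> u \<in> S \<or> v \<in> S) \<Longrightarrow> q \<le> card S"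
    using linear_forest_vertex_cover[OF assms(4)] assms(6) by metis
  \<comment> \<open>With the hub in the clique of order \<open>n - 1\<close>, only
    \<open>2 * (q - 1) < m\<close> vertices remain for \<open>F\<close>. With the hub in a small
    clique, the vertices of \<open>F\<close> in the other small one cover all edges, so there are at
    least \<open>q\<close> of them.\<close>
  have lower3: "n - 1 + (q - 1) + (q - 1) < r" if "0 < q"
  proof (rule gt[of _ _ "block (n - 1) (q - 1)"])
    show "card {u \<in> {..<n - 1 + (q - 1) + (q - 1)}. block (n - 1) (q - 1) u = j} < n" for j
      by (rule card_block_less) (use assms(1,3) q(1) in linarith)+
  next
    let ?c = "block (n - 1) (q - 1)" and ?V = "{..<n - 1 + (q - 1) + (q - 1)}"
    fix h g assume g: "inj_on g (pverts F)" "g ` pverts F \<subseteq> {u \<in> ?V. ?c u \<noteq> ?c h}"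
      "\<And>u v. (u, v) \<in> parcs F \<Longrightarrow> ?c (g u) \<noteq> ?c (g v)"
    note card = card_block[of "n - 1" "q - 1" "q - 1"]
    interpret pair_graph F by (rule pF)
    show False
    proof (cases "?c h = 0")
      case True
      then show False using card(4) q(1) that by (intro many[OF g(1,2)]) auto
    next
      case False
      define S where "S = {x \<in> pverts F. ?c (g x) \<noteq> 0}"
      \<comment> \<open>The small cliques have colours 1 and 2, so \<open>j\<close> is the one
        without the hub.\<close>
      define j where "j = 3 - ?c h"
      have le: "?c u \<le> 2" for u by (rule block_induct) auto
      have j: "j = 1 \<or> j = 2" using False le[of h] unfolding j_def by linarith
      have other: "?c u = 0 \<or> ?c u = j" if "?c u \<noteq> ?c h" for u
        using False le[of h] le[of u] that unfolding j_def by linarith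
      have vals: "?c (g x) = 0 \<or> ?c (g x) = j" if "x \<in> pverts F" for x
        using other[of "g x"] g(2) that by auto
      have "q \<le> card S"
      proof (rule q(2))
        fix u v assume uv: "(u, v) \<in> parcs F"
        show "u \<in> S \<or> v \<in> S"
          using g(3)[OF uv] in_arcsD1[OF uv] in_arcsD2[OF uv] by (auto simp: S_def)
      qed (auto simp: S_def)
      also have "card S \<le> card {u \<in> ?V. ?c u = j}"
      proof (rule card_inj_on_le)
        show "inj_on g S" using g(1) by (rule inj_on_subset) (auto simp: S_def)
        show "g ` S \<subseteq> {u \<in> ?V. ?c u = j}"
        proof (rule image_subsetI)
          fix x assume "x \<in> S"
          then have "x \<in> pverts F" "?c (g x) \<noteq> 0" unfolding S_def by blast+
          moreover from this have "?c (g x) = j" using vals by (metis (no_types))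
          ultimately show "g x \<in> {u \<in> ?V. ?c u = j}" using g(2) by blast
        qed
      qed simp
      also have "\<dots> = q - 1" using j card(2,3) by auto
      finally show False using that by simp
    qed
  qed
  have "\<lceil>3 * real m / 2\<rceil> - 1 \<le> int r"
  proof -
    have "3 * m \<le> 2 * (m div 2 + (m - 1) div 2 + (m - 1) div 2 + 2)"
      using assms(1,2) by presburger
    also have "\<dots> \<le> 2 * (r + 1)" using lower2 by simp
    finally have "3 * m \<le> 2 * (r + 1)" .
    then have "real (3 * m) \<le> real (2 * (r + 1))" by (simp only: of_nat_le_iff)
    then have "3 * real m / 2 \<le> real_of_int (int r + 1)" by simp
    then have "\<lceil>3 * real m / 2\<rceil> \<le> int r + 1" by (simp only: ceiling_le_iff)
    then show ?thesis by simp
  qed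
  moreover have "2 * int n - 1 \<le> int r" using lower1 assms(1) by linarith
  moreover have "int m + int n - int (odd_components F) - 2 \<le> int r"
  \<comment> \<open>For \<open>q = 0\<close> the bound is just \<open>n - 2\<close>, which
    \<open>lower1\<close> covers; otherwise \<open>m - odd_components F = 2 * q\<close> and
    \<open>lower3\<close> applies.\<close>
  proof (cases "q = 0")
    case True
    then show ?thesis using q(1) lower1 assms(1) by linarith
  next
    case False
    then show ?thesis using q(1) lower3 assms(1) by linarith
  qed
  moreover have "int r \<le> int m + int n - 2 + int (pa m)" using upper assms(1) by linarith
  ultimately show ?thesis unfolding r_def by simp
qed

end
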